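(* Let $a_1,a_2,b_1,b_2>0$ and $\lambda_1,\lambda_2\ge 0$, and let $G_1\sim\Gamma(a_1,b_1,\lambda_1)$ and $G_2\sim\Gamma(a_2,b_2,\lambda_2)$ be independent noncentral gamma random variables. Let $p_-$ be the density of $D:=G_1-G_2$. Then the following assertions hold. (i) $p_-$ is log-convex on $(0,\infty)$ if and only if $\lambda_1=0$ and $a_1\le 1$. (ii) $p_-$ is log-convex on $(-\infty,0)$ if and only if $\lambda_2=0$ and $a_2\le 1$. (iii) If $a_1\ge 1$ and $a_2\ge 1$, then $p_-$ is log-concave on $\mathbb{R}$. (iv) If $\lambda_1=\lambda_2=0$, then $p_-$ is log-concave on $\mathbb{R}$ if and only if $a_1\ge 1$ and $a_2\ge 1$.
   Context: For $a,b>0$ and $\lambda\ge 0$, the noncentral gamma distribution $\Gamma(a,b,\lambda)$ is the distribution on $(0,\infty)$ with characteristic function $\mathsf{E}[e^{itG}]=(1-ibt)^{-a}\exp\left(\frac{ibt\lambda}{1-ibt}\right)$, $t\in\mathbb{R}$. Equivalently, it has density $$f_{a,b,\lambda}(x)=e^{-\lambda}\sum_{k=0}^{\infty}\frac{\lambda^k}{k!}\,\frac{x^{a+k-1}e^{-x/b}}{b^{a+k}\Gamma(a+k)},\qquad x>0,$$ with the convention $0^0=1$, so that $f_{a,b,0}(x)=\frac{x^{a-1}e^{-x/b}}{b^a\Gamma(a)}$. The density of $D=G_1-G_2$ is taken to be the version given by the convolution formula $p_-(x)=\int_{\max\{0,-x\}}^{\infty}f_{a_1,b_1,\lambda_1}(x+y)\,f_{a_2,b_2,\lambda_2}(y)\,dy$,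 $x\in\mathbb{R}$. This is finite and positive for $x\ne0$; at $x=0$ the integral may be $+\infty$, in which case $p_-$ is not regarded as log-concave on $\mathbb{R}$. A positive function $h:I\to(0,\infty)$ on an interval $I\subseteq\mathbb{R}$ is log-convex on $I$ if $h(tx+(1-t)y)\le h(x)^t h(y)^{1-t}$ for all $x,y\in I$, $t\in[0,1]$, and log-concave on $I$ if the reverse inequality holds for all such $x,y,t$. *)

theory Defs
  imports "HOL-Probability.Probability"
begin

(* b is a scale parameter; the density vanishes on (-\<infinity>, 0]. For l = 0 only the term
   k = 0 survives, because 0 ^ 0 = 1, which leaves the ordinary gamma density. *)
definition ncgamma_density :: "real \<Rightarrow> real \<Rightarrow> real \<Rightarrow> real \<Rightarrow> real" where
  "ncgamma_density a b l x =
     (if x > 0 then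
        exp (- l) * (\<Sum>k. l ^ k / fact k *
          (x powr (a + real k - 1) * exp (- x / b) / (b powr (a + real k) * Gamma (a + real k))))
      else 0)"

(* The convolution version of the density of G1 - G2. It takes values in [0, \<infinity>],
   since the integral may diverge at x = 0. *)
definition ncgamma_diff_density ::
    "real \<Rightarrow> real \<Rightarrow> real \<Rightarrow> real \<Rightarrow> real \<Rightarrow> real \<Rightarrow> real \<Rightarrow> ennreal" where
  "ncgamma_diff_density a1 b1 l1 a2 b2 l2 x =
     (\<integral>\<^sup>+y\<in>{max 0 (- x)<..}.
        ennreal (ncgamma_density a1 b1 l1 (x + y)) * ennreal (ncgamma_density a2 b2 l2 y) \<partial>lborel)"

(* Both notions require h to take values in (0, \<infinity>) on I; in particular a function that is
   infinite somewhere on I is neither log-convex nor log-concave on I. *)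
definition log_convex_on :: "real set \<Rightarrow> (real \<Rightarrow> ennreal) \<Rightarrow> bool" where
  "log_convex_on I h \<longleftrightarrow>
     is_interval I \<and> (\<forall>x\<in>I. 0 < h x \<and> h x < \<infinity>) \<and>
     (\<forall>x\<in>I. \<forall>y\<in>I. \<forall>t\<in>{0..1}.
        enn2real (h (t * x + (1 - t) * y)) \<le> enn2real (h x) powr t * enn2real (h y) powr (1 - t))"

definition log_concave_on :: "real set \<Rightarrow> (real \<Rightarrow> ennreal) \<Rightarrow> bool" where
  "log_concave_on I h \<longleftrightarrow>
     is_interval I \<and> (\<forall>x\<in>I. 0 < h x \<and> h x < \<infinity>) \<and>
     (\<forall>x\<in>I. \<forall>y\<in>I. \<forall>t\<in>{0..1}.
        enn2real (h (t * x + (1 - t) * y)) \<ge> enn2real (h x) powr t * enn2real (h y) powr (1 - t))"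

lemma (in prob_space) distributed_ncgamma_diff:
  assumes G1: "distributed M lborel G1 (\<lambda>x. ennreal (ncgamma_density a1 b1 l1 x))"
    and G2: "distributed M lborel G2 (\<lambda>x. ennreal (ncgamma_density a2 b2 l2 x))"
    and ind: "indep_var borel G1 borel G2"
  shows "distributed M lborel (\<lambda>\<omega>. G1 \<omega> - G2 \<omega>) (ncgamma_diff_density a1 b1 l1 a2 b2 l2)"
proof -
  let ?f = "\<lambda>x. ennreal (ncgamma_density a1 b1 l1 x)"
  let ?g = "\<lambda>x. ennreal (ncgamma_density a2 b2 l2 x)"
  have [measurable]: "?f \<in> borel_measurable borel" "?g \<in> borel_measurable borel"
    using G1 G2 by (auto simp: distributed_def)
  have "distributed M lborel (\<lambda>\<omega>. 0 + (-1) * G2 \<omega>) (\<lambda>x. ?g ((x - 0) / (-1)) / ennreal \<bar>-1\<bar>)"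
    using G2 by (rule distributed_affine) simp
  then have neg: "distributed M lborel (\<lambda>\<omega>. - G2 \<omega>) (\<lambda>x. ?g (- x))"
    by (simp add: divide_ennreal_def)
  have "indep_var borel ((\<lambda>x. x) \<circ> G1) borel (uminus \<circ> G2)"
    by (rule indep_var_compose[OF ind]) auto
  then have ind': "indep_var borel G1 borel (\<lambda>\<omega>. - G2 \<omega>)"
    by (simp add: comp_def)
  have "(\<integral>\<^sup>+y. ?f (x - y) * ?g (- y) \<partial>lborel) = ncgamma_diff_density a1 b1 l1 a2 b2 l2 x" for x
  proof -
    have "(\<integral>\<^sup>+y. ?f (x - y) * ?g (- y) \<partial>lborel) = (\<integral>\<^sup>+y. ?f (x + y) * ?g y \<partial>lborel)"
      by (subst nn_integral_real_affine[where c = "-1" and t = 0]) simp_all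
    also have "\<dots> = ncgamma_diff_density a1 b1 l1 a2 b2 l2 x"
      unfolding ncgamma_diff_density_def
      by (intro nn_integral_cong) (auto simp: indicator_def ncgamma_density_def)
    finally show ?thesis .
  qed
  with distributed_convolution[OF ind' G1 neg] show ?thesis
    by simp
qed

end

theory Submission
  imports Defs
begin

text \<open>The criteria for log-convexity come from the tilted density \<open>q x = exp (x / b1) * p x\<close> on
  \<open>x > 0\<close>, which grows more slowly than any exponential. If \<open>p\<close> is log-convex, then \<open>ln q\<close> is convex and
  sublinear, hence \<open>q\<close> is nonincreasing; but \<open>q\<close> dominates a positive power of \<open>x\<close> unless
  \<open>l1 = 0\<close> and \<open>a1 \<le> 1\<close>. Conversely, for \<open>l1 = 0\<close> and \<open>a1 \<le> 1\<close> the density of \<open>G1\<close> is log-convex, and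
  so is the mixture \<open>p\<close> of its translates. If \<open>p\<close> is log-concave and \<open>l1 = 0\<close>, the same argument applied
  to \<open>- ln q\<close> shows that \<open>q\<close> is nondecreasing, whereas \<open>q\<close> tends to 0 for \<open>a1 < 1\<close>. The negative
  half-line and the condition on \<open>a2\<close> follow by exchanging \<open>G1\<close> and \<open>G2\<close>.

  For \<open>a1, a2 \<ge> 1\<close> both densities are log-concave, and log-concavity passes to \<open>p\<close> by the
  Prekopa--Leindler inequality. The log-concavity of the noncentral density is a Turan inequality for
  the power series \<open>\<Sum>k. z ^ k / (k! * Gamma (a + k))\<close>.\<close>

subsection \<open>A Bessel-type power series\<close>

text \<open>For \<open>z > 0\<close> this is \<open>z powr ((1 - a) / 2)\<close> times the modified
  Bessel function of order \<open>a - 1\<close> at \<open>2 * sqrt z\<close>.\<close>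

definition bessel_series :: "real \<Rightarrow> real \<Rightarrow> real" where
  "bessel_series a z = (\<Sum>k. z ^ k / (fact k * Gamma (a + real k)))"

section \<open>Convergence and growth of the series\<close>

lemma pos_not_nonpos_Int: "x > 0 \<Longrightarrow> x \<notin> \<int>\<^sub>\<le>\<^sub>0" for x :: real
  by (auto elim!: nonpos_Ints_cases')

text \<open>By the functional equation of Gamma, consecutive terms have ratio
  \<open>M / (a + n)\<close>, of absolute value at most 1/2 as soon as \<open>n\<close> exceeds
  \<open>2 * \<bar>M\<bar>\<close>. Convergence without the factorial is what yields the geometric
  bound that follows.\<close>

lemma summable_power_over_Gamma:
  fixes a :: real
  assumes "a > 0"
  shows "summable (\<lambda>k. M ^ k / Gamma (a + real k))"
proof -
  obtain N :: nat where N: "2 * \<bar>M\<bar> < real N"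
    using reals_Archimedean2 by blast
  show ?thesis
  proof (rule summable_ratio_test[where c = "1/2" and N = N])
    fix n assume n: "N \<le> n"
    have G: "Gamma (a + real (Suc n)) = (a + real n) * Gamma (a + real n)"
      using Gamma_plus1[OF pos_not_nonpos_Int, of "a + real n"] assms by (simp add: add_ac)
    have pos: "Gamma (a + real n) > 0" using assms by (intro Gamma_real_pos) simp
    have an: "2 * \<bar>M\<bar> \<le> a + real n" using N n assms by linarith
    have "norm (M ^ Suc n / Gamma (a + real (Suc n))) =
        \<bar>M\<bar> / (a + real n) * norm (M ^ n / Gamma (a + real n))"
      unfolding G using assms pos by (simp add: abs_mult power_abs)
    also have "\<dots> \<le> 1/2 * norm (M ^ n / Gamma (a + real n))"
      using an assms by (intro mult_right_mono) (auto simp: field_simps)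
    finally show "norm (M ^ Suc n / Gamma (a + real (Suc n))) \<le> 1/2 * norm (M ^ n / Gamma (a + real n))" .
  qed simp
qed

text \<open>The terms of the convergent series with \<open>M = 1 / \<epsilon>\<close> are
  bounded.\<close>

lemma Gamma_dominates_geometric:
  fixes a \<epsilon> :: real
  assumes "a > 0" "\<epsilon> > 0"
  obtains C where "C > 0" "\<And>k. 1 / Gamma (a + real k) \<le> C * \<epsilon> ^ k"
proof -
  have "(\<lambda>k. (1 / \<epsilon>) ^ k / Gamma (a + real k)) \<longlonglongrightarrow> 0"
    using summable_power_over_Gamma[OF assms(1)] by (rule summable_LIMSEQ_zero)
  then have "Bseq (\<lambda>k. (1 / \<epsilon>) ^ k / Gamma (a + real k))"
    by (intro convergent_imp_Bseq convergentI)
  then obtain C where "C > 0" and C: "\<And>k. norm ((1 / \<epsilon>) ^ k / Gamma (a + real k)) \<le> C"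
    by (auto elim: BseqE)
  have "1 / Gamma (a + real k) \<le> C * \<epsilon> ^ k" for k
  proof -
    have "(1 / \<epsilon>) ^ k / Gamma (a + real k) \<le> C"
      using C[of k] unfolding real_norm_def by (rule order_trans[OF abs_ge_self])
    then have "(1 / \<epsilon>) ^ k / Gamma (a + real k) * \<epsilon> ^ k \<le> C * \<epsilon> ^ k"
      using assms(2) by (intro mult_right_mono) auto
    then show ?thesis using assms(2) by (simp add: power_one_over)
  qed
  with \<open>C > 0\<close> show ?thesis by (rule that)
qed

lemma summable_bessel_series:
  assumes "a > 0"
  shows "summable (\<lambda>k. z ^ k / (fact k * Gamma (a + real k)))"
proof (rule summable_comparison_test'[OF summable_power_over_Gamma[OF assms, of "\<bar>z\<bar>"]])
  fix n
  have "Gamma (a + real n) > 0" using assms by (intro Gamma_real_pos) simp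
  moreover have "1 * Gamma (a + real n) \<le> fact n * Gamma (a + real n)"
    using calculation by (intro mult_right_mono) auto
  ultimately show "norm (z ^ n / (fact n * Gamma (a + real n))) \<le> \<bar>z\<bar> ^ n / Gamma (a + real n)"
    by (auto simp: power_abs abs_mult intro!: divide_left_mono mult_pos_pos)
qed

lemma bessel_series_ge_term:
  assumes "a > 0" "z \<ge> 0"
  shows "z ^ k / (fact k * Gamma (a + real k)) \<le> bessel_series a z"
proof -
  have "sum (\<lambda>k. z ^ k / (fact k * Gamma (a + real k))) {k} \<le> bessel_series a z"
    unfolding bessel_series_def
    using assms Gamma_real_pos[of "a + real _"]
    by (intro sum_le_suminf summable_bessel_series) (auto intro!: divide_nonneg_nonneg mult_nonneg_nonneg less_imp_le)
  then show ?thesis by simp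
qed

lemma bessel_series_pos:
  assumes "a > 0" "z \<ge> 0"
  shows "bessel_series a z > 0"
  by (rule less_le_trans[OF _ bessel_series_ge_term[OF assms, of 0]])
    (use Gamma_real_pos[OF assms(1)] in simp)

text \<open>The geometric bound on \<open>1 / Gamma (a + k)\<close> compares the series term by term
  with \<open>C\<close> times the exponential series at \<open>\<epsilon> * z\<close>.\<close>

lemma bessel_series_subexponential:
  assumes "a > 0" "\<epsilon> > 0"
  obtains C where "C > 0" "\<And>z. z \<ge> 0 \<Longrightarrow> bessel_series a z \<le> C * exp (\<epsilon> * z)"
proof -
  obtain C where "C > 0" and C: "\<And>k. 1 / Gamma (a + real k) \<le> C * \<epsilon> ^ k"
    using Gamma_dominates_geometric[OF assms] by blast
  have "bessel_series a z \<le> C * exp (\<epsilon> * z)" if "z \<ge> 0" for z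
  proof -
    have s: "(\<lambda>k. C * ((\<epsilon> * z) ^ k / fact k)) sums (C * exp (\<epsilon> * z))"
      using exp_converges[of "\<epsilon> * z"] by (intro sums_mult) (simp add: divide_inverse mult.commute)
    have "z ^ k / (fact k * Gamma (a + real k)) \<le> C * ((\<epsilon> * z) ^ k / fact k)" for k
      using mult_left_mono[OF C[of k], of "z ^ k / fact k"] that
      by (simp add: power_mult_distrib mult_ac)
    then show ?thesis
      unfolding bessel_series_def
      using suminf_le[OF _ summable_bessel_series[OF assms(1)] sums_summable[OF s]] sums_unique[OF s]
      by simp
  qed
  with \<open>C > 0\<close> show ?thesis by (rule that)
qed

text \<open>The factor \<open>k + 1\<close> from differentiation cancels against the factorial,
  which leaves the same series with the parameter raised by one.\<close>

lemma bessel_series_deriv: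
  assumes "a > 0"
  shows "(bessel_series a has_real_derivative bessel_series (a + 1) z) (at z)"
proof -
  let ?c = "\<lambda>k. 1 / (fact k * Gamma (a + real k))"
  have "summable (\<lambda>k. ?c k * y ^ k)" for y
    using summable_bessel_series[OF assms, of y] by simp
  then have "((\<lambda>x. \<Sum>k. ?c k * x ^ k) has_real_derivative (\<Sum>k. diffs ?c k * z ^ k)) (at z)"
    by (rule termdiffs_strong_converges_everywhere)
  moreover have "diffs ?c k * z ^ k = z ^ k / (fact k * Gamma (a + 1 + real k))" for k
    by (simp add: diffs_def add_ac del: of_nat_Suc)  (simp add: add_ac)
  ultimately show ?thesis
    by (simp add: bessel_series_def[abs_def])
qed

text \<open>The factors are paired crosswise: \<open>fact j\<close> with
  \<open>Gamma (\<nu> + (n - j))\<close> and \<open>fact (n - j)\<close> with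
  \<open>Gamma (\<mu> + j)\<close>. Up to Gamma factors independent of \<open>j\<close>, each pair
  is the reciprocal of a binomial coefficient, and Vandermonde's identity sums the products.\<close>

lemma sum_reciprocal_Gamma_convolution:
  fixes \<mu> \<nu> :: real
  assumes "\<mu> > 0" "\<nu> > 0"
  shows "(\<Sum>j\<le>n. 1 / (fact j * Gamma (\<mu> + real j)) * (1 / (fact (n - j) * Gamma (\<nu> + real (n - j))))) =
    ((\<mu> + \<nu> + 2 * real n - 2) gchoose n) / (Gamma (\<mu> + real n) * Gamma (\<nu> + real n))"
proof -
  have "1 / (fact j * Gamma (\<mu> + real j)) * (1 / (fact (n - j) * Gamma (\<nu> + real (n - j)))) =
      ((\<nu> + real n - 1) gchoose j) * ((\<mu> + real n - 1) gchoose (n - j)) /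
        (Gamma (\<mu> + real n) * Gamma (\<nu> + real n))" if "j \<le> n" for j
  proof -
    have pos: "Gamma (\<mu> + real n) > 0" "Gamma (\<nu> + real n) > 0"
      using assms by (auto intro!: Gamma_real_pos)
    have 1: "(\<nu> + real n - 1) gchoose j = Gamma (\<nu> + real n) / (fact j * Gamma (\<nu> + real (n - j)))"
      using gbinomial_Gamma[of "\<nu> + real n - 1" j] pos_not_nonpos_Int[of "\<nu> + real n"] assms that
      by (simp add: of_nat_diff algebra_simps)
    have 2: "(\<mu> + real n - 1) gchoose (n - j) = Gamma (\<mu> + real n) / (fact (n - j) * Gamma (\<mu> + real j))"
      using gbinomial_Gamma[of "\<mu> + real n - 1" "n - j"] pos_not_nonpos_Int[of "\<mu> + real n"] assms that
      by (simp add: of_nat_diff algebra_simps)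
    show ?thesis unfolding 1 2 using pos by simp
  qed
  then have "(\<Sum>j\<le>n. 1 / (fact j * Gamma (\<mu> + real j)) * (1 / (fact (n - j) * Gamma (\<nu> + real (n - j))))) =
      (\<Sum>j\<in>{0..n}. ((\<nu> + real n - 1) gchoose j) * ((\<mu> + real n - 1) gchoose (n - j))) /
        (Gamma (\<mu> + real n) * Gamma (\<nu> + real n))"
    by (simp add: sum_divide_distrib atMost_atLeast0)
  also have "\<dots> = ((\<mu> + \<nu> + 2 * real n - 2) gchoose n) / (Gamma (\<mu> + real n) * Gamma (\<nu> + real n))"
    unfolding gbinomial_Vandermonde by (simp add: algebra_simps)
  finally show ?thesis .
qed

lemma bessel_series_mult_sums:
  assumes "\<mu> > 0" "\<nu> > 0"
  shows "(\<lambda>n. ((\<mu> + \<nu> + 2 * real n - 2) gchoose n) / (Gamma (\<mu> + real n) * Gamma (\<nu> + real n)) * z ^ n)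
    sums (bessel_series \<mu> z * bessel_series \<nu> z)"
proof -
  let ?c = "\<lambda>a k. z ^ k / (fact k * Gamma (a + real k))"
  have s: "summable (\<lambda>k. norm (?c a k))" if "a > 0" for a
  proof -
    have "norm (?c a k) = \<bar>z\<bar> ^ k / (fact k * Gamma (a + real k))" for k
      using Gamma_real_pos[of "a + real k"] that by (simp add: power_abs abs_mult)
    with summable_bessel_series[OF that, of "\<bar>z\<bar>"] show ?thesis by simp
  qed
  have "(\<lambda>n. \<Sum>j\<le>n. ?c \<mu> j * ?c \<nu> (n - j)) sums (bessel_series \<mu> z * bessel_series \<nu> z)"
    unfolding bessel_series_def using assms by (intro Cauchy_product_sums s)
  moreover have "(\<Sum>j\<le>n. ?c \<mu> j * ?c \<nu> (n - j)) =
      ((\<mu> + \<nu> + 2 * real n - 2) gchoose n) / (Gamma (\<mu> + real n) * Gamma (\<nu> + real n)) * z ^ n" for n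
    unfolding sum_reciprocal_Gamma_convolution[OF assms, symmetric] sum_distrib_right
    by (intro sum.cong) (auto simp: power_add[symmetric])
  ultimately show ?thesis by simp
qed

text \<open>With the Cauchy products summed by Vandermonde's identity, both sides carry the same binomial
  coefficient, so that the inequality holds coefficientwise.\<close>

lemma bessel_series_turan:
  assumes a: "a > 0" and z: "z \<ge> 0"
  shows "bessel_series a z * bessel_series (a + 2) z \<le> (bessel_series (a + 1) z)\<^sup>2"
proof -
  have "((a + (a + 2) + 2 * real n - 2) gchoose n) / (Gamma (a + real n) * Gamma (a + 2 + real n)) * z ^ n
      \<le> ((a + 1 + (a + 1) + 2 * real n - 2) gchoose n) / (Gamma (a + 1 + real n) * Gamma (a + 1 + real n)) * z ^ n"
    for n
  proof (intro mult_right_mono)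
    have pos: "Gamma (a + real n) > 0" using a by (intro Gamma_real_pos) simp
    have G1: "Gamma (a + 1 + real n) = (a + real n) * Gamma (a + real n)"
      using Gamma_plus1[OF pos_not_nonpos_Int, of "a + real n"] a by (simp add: add_ac)
    have G2: "Gamma (a + 2 + real n) = (a + 1 + real n) * ((a + real n) * Gamma (a + real n))"
      using Gamma_plus1[OF pos_not_nonpos_Int, of "a + 1 + real n"] a G1 by (simp add: add_ac)
    \<comment> \<open>The common binomial coefficient is a rising factorial of a positive number,
      hence nonnegative. What remains is to compare the denominators, that is,
      \<open>(a + n) * (a + n + 1)\<close> with the square of \<open>a + n\<close>.\<close>
    have "(2 * a + 2 * real n) gchoose n = (pochhammer (2 * a + real n + 1) n) / fact n"
      by (simp add: gbinomial_pochhammer' algebra_simps)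
    then have nn: "(2 * a + 2 * real n) gchoose n \<ge> 0"
      using a by (auto intro!: divide_nonneg_nonneg pochhammer_nonneg)
    have "((2 * a + 2 * real n) gchoose n) / (Gamma (a + real n) * Gamma (a + 2 + real n))
       \<le> ((2 * a + 2 * real n) gchoose n) / (Gamma (a + 1 + real n) * Gamma (a + 1 + real n))"
      unfolding G1 G2 using a pos nn
      by (intro divide_left_mono mult_pos_pos) (auto simp: algebra_simps)
    then show "((a + (a + 2) + 2 * real n - 2) gchoose n) / (Gamma (a + real n) * Gamma (a + 2 + real n))
      \<le> ((a + 1 + (a + 1) + 2 * real n - 2) gchoose n) / (Gamma (a + 1 + real n) * Gamma (a + 1 + real n))"
      by (simp add: algebra_simps)
  qed (use z in simp)
  from sums_le[OF this bessel_series_mult_sums bessel_series_mult_sums] show ?thesis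
    unfolding power2_eq_square using a by linarith
qed

text \<open>Each differentiation raises the parameter by one, so the sign of the second derivative
  of the logarithm is decided by the Turan inequality.\<close>

lemma ln_bessel_series_concave:
  assumes a: "a > 0"
  shows "concave_on {0..} (\<lambda>z. ln (bessel_series a z))"
proof (rule f''_le0_imp_concave)
  fix z :: real assume "z \<in> {0..}"
  then have z: "z \<ge> 0" by simp
  let ?S = "bessel_series"
  have pos: "?S a z > 0" by (rule bessel_series_pos[OF a z])
  show "((\<lambda>z. ln (?S a z)) has_real_derivative ?S (a + 1) z / ?S a z) (at z)"
    using bessel_series_deriv[OF a, of z] pos by (auto intro!: derivative_eq_intros)
  show "((\<lambda>z. ?S (a + 1) z / ?S a z) has_real_derivative
      (?S (a + 2) z * ?S a z - ?S (a + 1) z * ?S (a + 1) z) / (?S a z * ?S a z)) (at z)"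
    using bessel_series_deriv[OF a, of z] bessel_series_deriv[of "a + 1" z] a pos
    by (auto intro!: derivative_eq_intros simp: add_ac)
  show "(?S (a + 2) z * ?S a z - ?S (a + 1) z * ?S (a + 1) z) / (?S a z * ?S a z) \<le> 0"
    using bessel_series_turan[OF a z] by (simp add: divide_le_0_iff power2_eq_square mult_ac)
qed simp

subsection \<open>The Prekopa--Leindler inequality on the real line\<close>

lemma emeasure_lborel_affine_image:
  fixes A :: "real set"
  assumes "c > 0" and A: "A \<in> sets borel"
  shows "(\<lambda>x. t + c * x) ` A \<in> sets borel"
    and "emeasure lborel ((\<lambda>x. t + c * x) ` A) = ennreal c * emeasure lborel A"
proof -
  have eq: "(\<lambda>x. t + c * x) ` A = (\<lambda>x. (x - t) / c) -` A \<inter> space borel"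
    using assms(1) by (force simp: image_iff field_simps)
  show B: "(\<lambda>x. t + c * x) ` A \<in> sets borel"
    unfolding eq by (rule measurable_sets[OF _ A]) simp
  have "emeasure lborel ((\<lambda>x. t + c * x) ` A) =
      (\<integral>\<^sup>+x. indicator ((\<lambda>x. t + c * x) ` A) x \<partial>lborel)"
    using B by simp
  also have "\<dots> = ennreal c * (\<integral>\<^sup>+x. indicator ((\<lambda>x. t + c * x) ` A) (t + c * x) \<partial>lborel)"
    using B assms(1) by (subst nn_integral_real_affine[where c = c and t = t]) auto
  also have "(\<lambda>x. indicator ((\<lambda>x. t + c * x) ` A) (t + c * x)) = (indicator A :: real \<Rightarrow> ennreal)"
    using assms(1) by (auto simp: indicator_def fun_eq_iff)
  also have "(\<integral>\<^sup>+x. indicator A x \<partial>lborel) = emeasure lborel A"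
    using A by simp
  finally show "emeasure lborel ((\<lambda>x. t + c * x) ` A) = ennreal c * emeasure lborel A" .
qed

lemma brunn_minkowski_compact:
  fixes K L C :: "real set"
  assumes K: "compact K" "K \<noteq> {}" and L: "compact L" "L \<noteq> {}" and C: "C \<in> sets borel"
    and t: "0 < t" "t < 1"
    and sum: "\<And>x y. x \<in> K \<Longrightarrow> y \<in> L \<Longrightarrow> t * x + (1 - t) * y \<in> C"
  shows "ennreal t * emeasure lborel K + ennreal (1 - t) * emeasure lborel L \<le> emeasure lborel C"
proof -
  (* The translates of t K and (1 - t) L that share just one extreme point both lie in C. *)
  obtain M where M: "M \<in> K" "\<And>x. x \<in> K \<Longrightarrow> x \<le> M"
    using compact_attains_sup[OF K] by blast
  obtain m where m: "m \<in> L" "\<And>x. x \<in> L \<Longrightarrow> m \<le> x"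
    using compact_attains_inf[OF L] by blast
  let ?A = "(\<lambda>x. (1 - t) * m + t * x) ` K" and ?B = "(\<lambda>x. t * M + (1 - t) * x) ` L"
  let ?z = "t * M + (1 - t) * m"
  have bK: "K \<in> sets borel" and bL: "L \<in> sets borel"
    using K L by (auto intro: compact_imp_closed borel_closed)
  have A: "?A \<in> sets borel" "emeasure lborel ?A = ennreal t * emeasure lborel K"
    using emeasure_lborel_affine_image[OF t(1) bK] by auto
  have B: "?B \<in> sets borel" "emeasure lborel ?B = ennreal (1 - t) * emeasure lborel L"
    using emeasure_lborel_affine_image[OF _ bL, of "1 - t"] t by auto
  have "x \<in> {?z}" if xA: "x \<in> ?A" and xB: "x \<in> ?B" for x
  proof -
    have "x \<le> ?z" using xA M t by auto
    moreover have "?z \<le> x" using xB m t by (auto intro!: mult_left_mono)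
    ultimately show ?thesis by simp
  qed
  then have sub: "?A \<inter> (?B - {?z}) = {}" by blast
  have "emeasure lborel (?B - {?z}) = emeasure lborel ?B"
    using B by (intro emeasure_Diff_null_set) (auto simp: null_sets_def)
  then have "ennreal t * emeasure lborel K + ennreal (1 - t) * emeasure lborel L =
      emeasure lborel ?A + emeasure lborel (?B - {?z})"
    using A B by simp
  also have "\<dots> = emeasure lborel (?A \<union> (?B - {?z}))"
    using A B sub by (intro plus_emeasure) auto
  also have "\<dots> \<le> emeasure lborel C"
    using C sum M(1) m(1) by (intro emeasure_mono) (auto simp: add.commute)
  finally show ?thesis .
qed

text \<open>Lebesgue measure restricted to \<open>A\<close> is finite, so inner regularity applies
  to it. Adding a point of \<open>A\<close> to a compact subset makes it nonempty, as
  \<open>brunn_minkowski_compact\<close> demands.\<close>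

lemma emeasure_lborel_inner_regular:
  fixes A :: "real set"
  assumes A: "A \<in> sets borel" "A \<noteq> {}" and fin: "emeasure lborel A < \<infinity>"
  shows "emeasure lborel A = (SUP K\<in>{K. K \<subseteq> A \<and> compact K \<and> K \<noteq> {}}. emeasure lborel K)"
proof (rule antisym)
  let ?M = "density lborel (indicator A)"
  have eM: "emeasure ?M B = emeasure lborel B" if "B \<subseteq> A" "B \<in> sets borel" for B
    using that A by (simp add: emeasure_density Int_absorb1 flip: indicator_inter_arith)
  have "emeasure lborel A = emeasure ?M A" using A by (simp add: eM)
  also have "\<dots> = (SUP K\<in>{K. K \<subseteq> A \<and> compact K}. emeasure ?M K)"
    using A fin by (intro inner_regular) (auto simp: emeasure_density)
  also have "\<dots> \<le> (SUP K\<in>{K. K \<subseteq> A \<and> compact K \<and> K \<noteq> {}}. emeasure lborel K)"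
  proof (rule SUP_least)
    fix K assume K: "K \<in> {K. K \<subseteq> A \<and> compact K}"
    obtain a where "a \<in> A" using A by blast
    have "emeasure ?M K = emeasure lborel K"
      using K by (intro eM) (auto intro: compact_imp_closed borel_closed)
    also have "\<dots> \<le> emeasure lborel (insert a K)"
      using K by (intro emeasure_mono) (auto intro: borel_compact)
    also have "\<dots> \<le> (SUP K\<in>{K. K \<subseteq> A \<and> compact K \<and> K \<noteq> {}}. emeasure lborel K)"
      using K \<open>a \<in> A\<close> by (intro SUP_upper) auto
    finally show "emeasure ?M K \<le> (SUP K\<in>{K. K \<subseteq> A \<and> compact K \<and> K \<noteq> {}}. emeasure lborel K)" .
  qed
  finally show "emeasure lborel A \<le> (SUP K\<in>{K. K \<subseteq> A \<and> compact K \<and> K \<noteq> {}}. emeasure lborel K)" .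
  show "(SUP K\<in>{K. K \<subseteq> A \<and> compact K \<and> K \<noteq> {}}. emeasure lborel K) \<le> emeasure lborel A"
    using A by (intro SUP_least emeasure_mono) auto
qed

text \<open>Letting \<open>C\<close> be any Borel set that contains the combinations avoids the
  measurability of a Minkowski sum. The compact case extends by taking suprema over the two inner
  approximations separately.\<close>

lemma brunn_minkowski_real:
  fixes A B C :: "real set"
  assumes A: "A \<in> sets borel" "A \<noteq> {}" "emeasure lborel A < \<infinity>"
    and B: "B \<in> sets borel" "B \<noteq> {}" "emeasure lborel B < \<infinity>"
    and C: "C \<in> sets borel"
    and t: "0 < t" "t < 1"
    and sum: "\<And>x y. x \<in> A \<Longrightarrow> y \<in> B \<Longrightarrow> t * x + (1 - t) * y \<in> C"
  shows "ennreal t * emeasure lborel A + ennreal (1 - t) * emeasure lborel B \<le> emeasure lborel C"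
proof -
  let ?\<K> = "\<lambda>A. {K :: real set. K \<subseteq> A \<and> compact K \<and> K \<noteq> {}}"
  have ne: "?\<K> A \<noteq> {}" "?\<K> B \<noteq> {}"
    using A(2) B(2) by (metis (mono_tags, lifting) Collect_empty_eq compact_sing empty_subsetI ex_in_conv insert_not_empty insert_subset)+
  have "ennreal t * emeasure lborel A + ennreal (1 - t) * emeasure lborel B =
      (SUP K\<in>?\<K> A. SUP L\<in>?\<K> B. ennreal t * emeasure lborel K + ennreal (1 - t) * emeasure lborel L)"
    unfolding emeasure_lborel_inner_regular[OF A] emeasure_lborel_inner_regular[OF B]
      SUP_mult_left_ennreal ennreal_SUP_add_left[OF ne(1), symmetric] ennreal_SUP_add_right[OF ne(2)]
    by (rule SUP_commute)
  also have "\<dots> \<le> emeasure lborel C"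
    using C t sum by (intro SUP_least brunn_minkowski_compact) auto
  finally show ?thesis .
qed

text \<open>The value \<open>f x\<close> is the length of the interval of levels between 0 and
  \<open>f x\<close>; Tonelli's theorem exchanges the integrals over points and levels.\<close>

lemma nn_integral_layer_cake:
  fixes f :: "real \<Rightarrow> real"
  assumes [measurable]: "f \<in> borel_measurable borel" and nn: "\<And>x. f x \<ge> 0"
  shows "(\<integral>\<^sup>+x. ennreal (f x) \<partial>lborel) =
    (\<integral>\<^sup>+s. indicator {0<..} s * emeasure lborel {x. s < f x} \<partial>lborel)"
proof -
  let ?i = "\<lambda>x s. indicator {0<..} s * indicator {x. s < f x} x :: ennreal"
  have "ennreal (f x) = (\<integral>\<^sup>+s. ?i x s \<partial>lborel)" for x
  proof -
    have "(\<integral>\<^sup>+s. ?i x s \<partial>lborel) = (\<integral>\<^sup>+s. indicator {0<..<f x} s \<partial>lborel)"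
      by (intro nn_integral_cong) (auto simp: indicator_def)
    then show ?thesis using nn[of x] by simp
  qed
  then have "(\<integral>\<^sup>+x. ennreal (f x) \<partial>lborel) = (\<integral>\<^sup>+x. \<integral>\<^sup>+s. ?i x s \<partial>lborel \<partial>lborel)"
    by simp
  also have "\<dots> = (\<integral>\<^sup>+s. \<integral>\<^sup>+x. ?i x s \<partial>lborel \<partial>lborel)"
    by (rule lborel_pair.Fubini'[symmetric]) (simp add: indicator_def)
  also have "\<dots> = (\<integral>\<^sup>+s. indicator {0<..} s * emeasure lborel {x. s < f x} \<partial>lborel)"
    by (intro nn_integral_cong) (simp add: nn_integral_cmult)
  finally show ?thesis .
qed

text \<open>Markov's inequality.\<close>

lemma emeasure_superlevel_finite:
  fixes f :: "real \<Rightarrow> real"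
  assumes [measurable]: "f \<in> borel_measurable borel"
    and fin: "(\<integral>\<^sup>+x. ennreal (f x) \<partial>lborel) < \<infinity>" and s: "s > 0"
  shows "emeasure lborel {x. s < f x} < \<infinity>"
proof -
  have "ennreal s * emeasure lborel {x. s < f x} = (\<integral>\<^sup>+x. ennreal s * indicator {x. s < f x} x \<partial>lborel)"
    by (simp add: nn_integral_cmult)
  also have "\<dots> \<le> (\<integral>\<^sup>+x. ennreal (f x) \<partial>lborel)"
    by (intro nn_integral_mono) (auto simp: indicator_def intro: ennreal_leI)
  finally have "ennreal s * emeasure lborel {x. s < f x} < \<infinity>"
    using fin by (rule le_less_trans)
  then show ?thesis
    using s by (auto simp: ennreal_mult_less_top)
qed

text \<open>At a level \<open>s\<close> strictly between 0 and 1 both superlevel sets are nonempty,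
  and their combinations lie in the superlevel set of \<open>h\<close> because the weighted
  geometric mean of two numbers above \<open>s\<close> exceeds \<open>s\<close>. Brunn-Minkowski at
  each level, integrated by the layer cake formula, gives the claim.\<close>

lemma prekopa_leindler_normalised:
  fixes f g h :: "real \<Rightarrow> real"
  assumes meas [measurable]: "f \<in> borel_measurable borel" "g \<in> borel_measurable borel" "h \<in> borel_measurable borel"
    and nn: "\<And>x. f x \<ge> 0" "\<And>x. g x \<ge> 0" "\<And>x. h x \<ge> 0"
    and sup_f: "\<And>x. f x \<le> 1" "\<And>s. s < 1 \<Longrightarrow> \<exists>x. s < f x"
    and sup_g: "\<And>x. g x \<le> 1" "\<And>s. s < 1 \<Longrightarrow> \<exists>x. s < g x"
    and fin: "(\<integral>\<^sup>+x. ennreal (f x) \<partial>lborel) < \<infinity>" "(\<integral>\<^sup>+x. ennreal (g x) \<partial>lborel) < \<infinity>"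
    and t: "0 < t" "t < 1"
    and le: "\<And>x y. f x powr t * g y powr (1 - t) \<le> h (t * x + (1 - t) * y)"
  shows "ennreal t * (\<integral>\<^sup>+x. ennreal (f x) \<partial>lborel) + ennreal (1 - t) * (\<integral>\<^sup>+x. ennreal (g x) \<partial>lborel)
    \<le> (\<integral>\<^sup>+x. ennreal (h x) \<partial>lborel)"
proof -
  let ?m = "\<lambda>f s. emeasure lborel {x :: real. s < f x}"
  have meas_m [measurable]: "?m u \<in> borel_measurable borel" if [measurable]: "u \<in> borel_measurable borel" for u :: "real \<Rightarrow> real"
  proof -
    have "(\<lambda>s. \<integral>\<^sup>+x. indicator {x. s < u x} x \<partial>lborel) \<in> borel_measurable lborel"
      by (rule lborel.borel_measurable_nn_integral) (simp add: indicator_def)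
    then show ?thesis by simp
  qed
  have levels: "ennreal t * ?m f s + ennreal (1 - t) * ?m g s \<le> ?m h s" if s: "s > 0" for s
  proof (cases "s < 1")
    case True
    have "s < h (t * x + (1 - t) * y)" if "s < f x" "s < g y" for x y
    proof -
      have "s = s powr t * s powr (1 - t)" using s by (simp flip: powr_add)
      also have "\<dots> < f x powr t * g y powr (1 - t)"
        using that s t by (intro mult_strict_mono powr_less_mono2) auto
      also have "\<dots> \<le> h (t * x + (1 - t) * y)" by (rule le)
      finally show ?thesis .
    qed
    then show ?thesis
      using True s t sup_f(2)[of s] sup_g(2)[of s] emeasure_superlevel_finite[OF _ fin(1) s]
        emeasure_superlevel_finite[OF _ fin(2) s]
      by (intro brunn_minkowski_real) auto
  next
    \<comment> \<open>At levels \<open>s \<ge> 1\<close> the superlevel sets of \<open>f\<close> and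
      \<open>g\<close> are empty, so the left-hand side is 0.\<close>
    case False
    then have "\<not> s < f x" "\<not> s < g x" for x
      using sup_f(1)[of x] sup_g(1)[of x] by linarith+
    then show ?thesis by simp
  qed
  have "ennreal t * (\<integral>\<^sup>+x. ennreal (f x) \<partial>lborel) + ennreal (1 - t) * (\<integral>\<^sup>+x. ennreal (g x) \<partial>lborel) =
      (\<integral>\<^sup>+s. indicator {0<..} s * (ennreal t * ?m f s + ennreal (1 - t) * ?m g s) \<partial>lborel)"
    by (simp add: nn_integral_layer_cake nn nn_integral_add nn_integral_cmult distrib_left mult.left_commute)
  also have "\<dots> \<le> (\<integral>\<^sup>+s. indicator {0<..} s * ?m h s \<partial>lborel)"
    using levels by (intro nn_integral_mono) (auto simp: indicator_def)
  also have "\<dots> = (\<integral>\<^sup>+x. ennreal (h x) \<partial>lborel)"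
    by (simp add: nn_integral_layer_cake nn)
  finally show ?thesis .
qed

text \<open>Dividing \<open>f\<close> and \<open>g\<close> by their suprema makes the superlevel sets of both nonempty at exactly the
  same levels. AM-GM then turns the additive bound into the multiplicative one.\<close>

lemma prekopa_leindler:
  fixes f g h :: "real \<Rightarrow> real"
  assumes meas [measurable]: "f \<in> borel_measurable borel" "g \<in> borel_measurable borel" "h \<in> borel_measurable borel"
    and nn: "\<And>x. f x \<ge> 0" "\<And>x. g x \<ge> 0" "\<And>x. h x \<ge> 0"
    and bdd: "bdd_above (range f)" "bdd_above (range g)"
    and int: "(\<integral>\<^sup>+x. ennreal (f x) \<partial>lborel) = ennreal I" "(\<integral>\<^sup>+x. ennreal (g x) \<partial>lborel) = ennreal J"
    and pos: "I > 0" "J > 0"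
    and t: "0 < t" "t < 1"
    and le: "\<And>x y. f x powr t * g y powr (1 - t) \<le> h (t * x + (1 - t) * y)"
  shows "ennreal (I powr t * J powr (1 - t)) \<le> (\<integral>\<^sup>+x. ennreal (h x) \<partial>lborel)"
proof -
  have Sup: "\<exists>S>0. (\<forall>x. u x \<le> S) \<and> (\<forall>s<1. \<exists>x. s * S < u x)"
    if u: "bdd_above (range u)" "(\<integral>\<^sup>+x. ennreal (u x) \<partial>lborel) = ennreal U" "U > 0" for u :: "real \<Rightarrow> real" and U
  proof -
    obtain x where x: "u x > 0"
    proof (rule ccontr)
      assume "\<not> thesis"
      with that have "\<And>x. u x \<le> 0" by (meson not_le)
      then have "(\<integral>\<^sup>+x. ennreal (u x) \<partial>lborel) = 0" by (simp add: ennreal_neg)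
      with u show False by simp
    qed
    have up: "u x \<le> (SUP x. u x)" for x using u(1) by (rule cSUP_upper[OF UNIV_I])
    with x have S: "(SUP x. u x) > 0" by (meson less_le_trans)
    moreover have "\<exists>x. s * (SUP x. u x) < u x" if "s < 1" for s
      using u(1) S that less_cSUP_iff[of UNIV u "s * (SUP x. u x)"] by auto
    ultimately show ?thesis using up by blast
  qed
  obtain F where F: "F > 0" "\<And>x. f x \<le> F" "\<And>s. s < 1 \<Longrightarrow> \<exists>x. s * F < f x"
    using Sup[OF bdd(1) int(1) pos(1)] by blast
  obtain G where G: "G > 0" "\<And>x. g x \<le> G" "\<And>s. s < 1 \<Longrightarrow> \<exists>x. s * G < g x"
    using Sup[OF bdd(2) int(2) pos(2)] by blast
  \<comment> \<open>Dividing \<open>f\<close> by \<open>F\<close> and \<open>g\<close> by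
    \<open>G\<close> divides their geometric mean by \<open>H\<close>, so the quotients satisfy the
    pointwise hypothesis with \<open>h / H\<close>.\<close>
  define H where "H = F powr t * G powr (1 - t)"
  have H: "H > 0" unfolding H_def using F G by simp
  have div: "(\<integral>\<^sup>+x. ennreal (u x / c) \<partial>lborel) = (\<integral>\<^sup>+x. ennreal (u x) \<partial>lborel) / ennreal c"
    if [measurable]: "u \<in> borel_measurable borel" and "\<And>x. u x \<ge> 0" "c > 0" for u :: "real \<Rightarrow> real" and c
    using that by (simp add: divide_ennreal[symmetric] nn_integral_divide)
  have intF: "(\<integral>\<^sup>+x. ennreal (f x / F) \<partial>lborel) = ennreal (I / F)"
    and intG: "(\<integral>\<^sup>+x. ennreal (g x / G) \<partial>lborel) = ennreal (J / G)"
    using F G nn pos by (simp_all add: div int divide_ennreal)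
  have "I powr t * J powr (1 - t) / H = (I / F) powr t * (J / G) powr (1 - t)"
    unfolding H_def using pos F G by (simp add: powr_divide)
  also have "\<dots> \<le> t * (I / F) + (1 - t) * (J / G)"
    using Youngs_inequality_0[of t "1 - t" "I / F" "J / G"] t pos F G by simp
  finally have "ennreal (I powr t * J powr (1 - t) / H) \<le> ennreal (t * (I / F) + (1 - t) * (J / G))"
    by (rule ennreal_leI)
  also have "\<dots> = ennreal t * (\<integral>\<^sup>+x. ennreal (f x / F) \<partial>lborel) + ennreal (1 - t) * (\<integral>\<^sup>+x. ennreal (g x / G) \<partial>lborel)"
    unfolding intF intG using t pos F G
    by (subst ennreal_plus) (simp_all add: ennreal_mult del: times_divide_eq_right)
  also have "\<dots> \<le> (\<integral>\<^sup>+x. ennreal (h x / H) \<partial>lborel)"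
  proof (rule prekopa_leindler_normalised)
    fix x y
    have "(f x / F) powr t * (g y / G) powr (1 - t) = f x powr t * g y powr (1 - t) / H"
      unfolding H_def using nn F G by (simp add: powr_divide)
    also have "\<dots> \<le> h (t * x + (1 - t) * y) / H"
      using le H by (simp add: divide_right_mono)
    finally show "(f x / F) powr t * (g y / G) powr (1 - t) \<le> h (t * x + (1 - t) * y) / H" .
  qed (use F G H nn t intF intG in \<open>auto simp: less_divide_eq divide_le_eq\<close>)
  also have "\<dots> = (\<integral>\<^sup>+x. ennreal (h x) \<partial>lborel) / ennreal H"
    using nn H by (simp add: div)
  finally have "ennreal (I powr t * J powr (1 - t)) / ennreal H \<le> (\<integral>\<^sup>+x. ennreal (h x) \<partial>lborel) / ennreal H"
    using H by (simp add: divide_ennreal)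
  then have "ennreal (I powr t * J powr (1 - t)) / ennreal H * ennreal H \<le> (\<integral>\<^sup>+x. ennreal (h x) \<partial>lborel) / ennreal H * ennreal H"
    by (rule mult_right_mono) simp
  then show ?thesis
    using H by (simp add: ennreal_divide_times)
qed

subsection \<open>Noncentral gamma densities\<close>

lemma ln_geometric_mean:
  fixes u v :: real
  assumes "u > 0" "v > 0"
  shows "ln (u powr t * v powr (1 - t)) = t * ln u + (1 - t) * ln v"
  using assms by (simp add: ln_mult ln_powr)

lemma powr_subexponential:
  fixes s \<epsilon> :: real
  assumes "s \<ge> 0" "\<epsilon> > 0"
  obtains C where "C > 0" "\<And>x. x > 0 \<Longrightarrow> x powr s \<le> C * exp (\<epsilon> * x)"
proof (cases "s = 0")
  case True
  show ?thesis by (rule that[of 1]) (use True assms in auto)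
next
  case False
  with assms have s: "s > 0" by simp
  show ?thesis
  \<comment> \<open>The constant comes from \<open>u \<le> exp u\<close> at
    \<open>u = \<epsilon> * x / s\<close>, raised to the power \<open>s\<close>.\<close>
  proof (rule that[of "(s / \<epsilon>) powr s"])
    fix x :: real assume x: "x > 0"
    have "x powr s = (s / \<epsilon>) powr s * (\<epsilon> * x / s) powr s"
      using s assms x by (simp flip: powr_mult)
    also have "(\<epsilon> * x / s) powr s \<le> exp (\<epsilon> * x / s) powr s"
      using s assms x exp_ge_add_one_self[of "\<epsilon> * x / s"] by (intro powr_mono2) (auto simp del: exp_ge_add_one_self)
    also have "\<dots> = exp (\<epsilon> * x)"
      using s by (simp add: exp_powr_real)
    finally show "x powr s \<le> (s / \<epsilon>) powr s * exp (\<epsilon> * x)"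
      by (simp add: mult_left_mono)
  qed (use s assms in simp)
qed

text \<open>Separating the \<open>k\<close>-th powers of \<open>x\<close> and \<open>b\<close>
  leaves a gamma kernel times the Bessel series at \<open>l * x / b\<close>; for
  \<open>l = 0\<close> the series is the constant \<open>1 / Gamma a\<close>.\<close>

lemma ncgamma_density_eq:
  assumes "a > 0" "b > 0" "x > 0"
  shows "ncgamma_density a b l x =
    exp (- l) / b powr a * (x powr (a - 1) * exp (- x / b) * bessel_series a (l * x / b))"
proof -
  have "l ^ k / fact k * (x powr (a + real k - 1) * exp (- x / b) / (b powr (a + real k) * Gamma (a + real k))) =
      x powr (a - 1) * exp (- x / b) / b powr a * ((l * x / b) ^ k / (fact k * Gamma (a + real k)))" for k
  proof -
    have "x powr (a + real k - 1) = x powr (a - 1) * x ^ k"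
      using assms by (simp add: powr_realpow[symmetric] powr_add[symmetric] algebra_simps)
    moreover have "b powr (a + real k) = b powr a * b ^ k"
      using assms by (simp add: powr_realpow[symmetric] powr_add)
    ultimately show ?thesis by (simp add: power_divide power_mult_distrib mult_ac)
  qed
  then have "ncgamma_density a b l x = exp (- l) *
      (\<Sum>k. x powr (a - 1) * exp (- x / b) / b powr a * ((l * x / b) ^ k / (fact k * Gamma (a + real k))))"
    unfolding ncgamma_density_def using assms(3) by (simp only: if_True)
  also have "\<dots> = exp (- l) * (x powr (a - 1) * exp (- x / b) / b powr a * bessel_series a (l * x / b))"
    unfolding bessel_series_def by (simp only: suminf_mult[OF summable_bessel_series[OF assms(1)]])
  finally show ?thesis by simp
qed

lemma ncgamma_density_measurable [measurable]: "ncgamma_density a b l \<in> borel_measurable borel"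
  unfolding ncgamma_density_def[abs_def] by measurable

lemma ncgamma_density_nonpos: "x \<le> 0 \<Longrightarrow> ncgamma_density a b l x = 0"
  by (simp add: ncgamma_density_def)

lemma ncgamma_density_pos:
  assumes "a > 0" "b > 0" "l \<ge> 0" "x > 0"
  shows "ncgamma_density a b l x > 0"
  using assms bessel_series_pos[of a "l * x / b"] by (simp add: ncgamma_density_eq)

lemma ncgamma_density_nonneg:
  assumes "a > 0" "b > 0" "l \<ge> 0"
  shows "ncgamma_density a b l x \<ge> 0"
  using ncgamma_density_pos[OF assms, of x] ncgamma_density_nonpos[of x a b l] by linarith

text \<open>Only the terms \<open>(a - 1) * ln x\<close> and \<open>ln\<close> of the series are not
  affine in \<open>x\<close>, so they alone decide concavity or convexity.\<close>

lemma ln_ncgamma_density: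
  assumes "a > 0" "b > 0" "l \<ge> 0" "x > 0"
  shows "ln (ncgamma_density a b l x) =
    ln (exp (- l) / b powr a) + (a - 1) * ln x - x / b + ln (bessel_series a (l * x / b))"
proof -
  define K where "K = exp (- l) / b powr a"
  have "K > 0" "bessel_series a (l * x / b) > 0"
    unfolding K_def using assms by (simp_all add: bessel_series_pos)
  then show ?thesis
    using assms by (simp add: ncgamma_density_eq K_def[symmetric] ln_mult ln_powr)
qed

text \<open>For \<open>a \<ge> 1\<close> both nonaffine terms of the logarithm are concave.
  Arguments outside the positive half-line are included because Prekopa-Leindler integrates over the
  whole line; there the left-hand side is 0.\<close>

lemma ncgamma_density_log_concave:
  assumes a: "a \<ge> 1" and b: "b > 0" and l: "l \<ge> 0" and t: "0 < t" "t < 1"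
  shows "ncgamma_density a b l x powr t * ncgamma_density a b l y powr (1 - t)
    \<le> ncgamma_density a b l (t * x + (1 - t) * y)"
proof (cases "x > 0 \<and> y > 0")
  case False
  then show ?thesis
    using a b l by (auto simp: ncgamma_density_nonpos ncgamma_density_nonneg not_less)
next
  case True
  then have x: "x > 0" and y: "y > 0" by auto
  let ?f = "ncgamma_density a b l" and ?z = "t * x + (1 - t) * y"
  let ?S = "\<lambda>x. bessel_series a (l * x / b)"
  have z: "?z > 0" using x y t by (simp add: add_pos_pos)
  have a0: "a > 0" using a by simp
  have 1: "(a - 1) * (t * ln x + (1 - t) * ln y) \<le> (a - 1) * ln ?z"
    using concave_onD[OF ln_concave, of "1 - t" x y] a x y t by (intro mult_left_mono) auto
  have "l * ?z / b = t * (l * x / b) + (1 - t) * (l * y / b)"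
    by (simp add: algebra_simps add_divide_distrib diff_divide_distrib)
  then have 2: "t * ln (?S x) + (1 - t) * ln (?S y) \<le> ln (?S ?z)"
    using concave_onD[OF ln_bessel_series_concave[OF a0], of "1 - t" "l * x / b" "l * y / b"] x y t l b
    by simp
  have "t * ln (?f x) + (1 - t) * ln (?f y) \<le> ln (?f ?z)"
    unfolding ln_ncgamma_density[OF a0 b l x] ln_ncgamma_density[OF a0 b l y] ln_ncgamma_density[OF a0 b l z]
    using 1 2 by (simp add: algebra_simps add_divide_distrib diff_divide_distrib)
  moreover have pos: "?f x > 0" "?f y > 0" "?f ?z > 0"
    using ncgamma_density_pos[OF a0 b l] x y z by auto
  ultimately have "ln (?f x powr t * ?f y powr (1 - t)) \<le> ln (?f ?z)"
    by (simp only: ln_geometric_mean)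
  then show ?thesis
    using pos by (subst (asm) ln_le_cancel_iff) auto
qed

text \<open>For \<open>a \<le> 1\<close> the term \<open>(a - 1) * ln x\<close> is convex, and for
  \<open>l = 0\<close> the term with the series is constant.\<close>

lemma central_ncgamma_density_log_convex:
  assumes a: "0 < a" "a \<le> 1" and b: "b > 0" and t: "0 \<le> t" "t \<le> 1" and x: "x > 0" and y: "y > 0"
  shows "ncgamma_density a b 0 (t * x + (1 - t) * y)
    \<le> ncgamma_density a b 0 x powr t * ncgamma_density a b 0 y powr (1 - t)"
proof -
  let ?f = "ncgamma_density a b 0" and ?z = "t * x + (1 - t) * y"
  have z: "?z > 0" using x y t by (cases "t = 0") (auto simp: add_pos_nonneg)
  have b0: "(0::real) \<le> 0" by simp
  have 1: "(a - 1) * ln ?z \<le> (a - 1) * (t * ln x + (1 - t) * ln y)"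
    using concave_onD[OF ln_concave, of "1 - t" x y] a x y t by (intro mult_left_mono_neg) auto
  have "ln (?f ?z) \<le> t * ln (?f x) + (1 - t) * ln (?f y)"
    unfolding ln_ncgamma_density[OF a(1) b b0 x] ln_ncgamma_density[OF a(1) b b0 y] ln_ncgamma_density[OF a(1) b b0 z]
    using 1 by (simp add: algebra_simps add_divide_distrib diff_divide_distrib)
  moreover have pos: "?f x > 0" "?f y > 0" "?f ?z > 0"
    using ncgamma_density_pos[OF a(1) b b0] x y z by auto
  ultimately have "ln (?f ?z) \<le> ln (?f x powr t * ?f y powr (1 - t))"
    by (simp only: ln_geometric_mean)
  then show ?thesis
    using pos by (subst (asm) ln_le_cancel_iff) auto
qed

text \<open>Half of \<open>\<epsilon>\<close> absorbs the power of \<open>x\<close>, the other half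
  the Bessel series. For \<open>a < 1\<close> the power is singular at 0, whence the restriction to
  \<open>x \<ge> x0 > 0\<close> in that case.\<close>

lemma ncgamma_density_upper_bound:
  assumes a: "a > 0" and b: "b > 0" and l: "l \<ge> 0" and \<epsilon>: "\<epsilon> > 0"
    and x0: "x0 > 0 \<or> a \<ge> 1"
  obtains C where "C > 0"
    "\<And>x. x > 0 \<Longrightarrow> x \<ge> x0 \<Longrightarrow> ncgamma_density a b l x \<le> C * exp ((\<epsilon> - 1 / b) * x)"
proof -
  obtain C1 where C1: "C1 > 0" "\<And>x. x > 0 \<Longrightarrow> x \<ge> x0 \<Longrightarrow> x powr (a - 1) \<le> C1 * exp (\<epsilon> / 2 * x)"
  proof (cases "a \<ge> 1")
    case True
    with \<epsilon> obtain C where "C > 0" "\<And>x. x > 0 \<Longrightarrow> x powr (a - 1) \<le> C * exp (\<epsilon> / 2 * x)"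
      using powr_subexponential[of "a - 1" "\<epsilon> / 2"] by (metis diff_ge_0_iff_ge half_gt_zero)
    then show ?thesis by (intro that) auto
  next
    case False
    show ?thesis
    proof (rule that[of "x0 powr (a - 1)"])
      fix x :: real assume "x > 0" "x \<ge> x0"
      with False x0 have "x powr (a - 1) \<le> x0 powr (a - 1) * 1"
        by (simp add: powr_mono2')
      also have "\<dots> \<le> x0 powr (a - 1) * exp (\<epsilon> / 2 * x)"
        using \<epsilon> \<open>x > 0\<close> by (intro mult_left_mono) auto
      finally show "x powr (a - 1) \<le> x0 powr (a - 1) * exp (\<epsilon> / 2 * x)" .
    qed (use False x0 in simp)
  qed
  \<comment> \<open>The rate is chosen so that \<open>\<delta> * l / b \<le> \<epsilon> / 2\<close>;
    writing \<open>l + 1\<close> keeps the denominator positive when \<open>l = 0\<close>.\<close>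
  define \<delta> where "\<delta> = \<epsilon> * b / (2 * (l + 1))"
  have \<delta>: "\<delta> > 0" unfolding \<delta>_def using \<epsilon> b l by simp
  obtain C2 where C2: "C2 > 0" "\<And>z. z \<ge> 0 \<Longrightarrow> bessel_series a z \<le> C2 * exp (\<delta> * z)"
    using bessel_series_subexponential[OF a \<delta>] by blast
  have "\<delta> * (l / b) \<le> \<epsilon> / 2"
    unfolding \<delta>_def using \<epsilon> b l by (simp add: field_simps)
  then have \<delta>l: "\<delta> * (l * x / b) \<le> \<epsilon> / 2 * x" if "x > 0" for x
    using mult_right_mono[of "\<delta> * (l / b)" "\<epsilon> / 2" x] that by simp
  define K where "K = exp (- l) / b powr a"
  have K: "K > 0" unfolding K_def using b by simp
  show ?thesis
  proof (rule that[of "K * (C1 * C2)"])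
    fix x :: real assume x: "x > 0" "x \<ge> x0"
    have "bessel_series a (l * x / b) \<le> C2 * exp (\<delta> * (l * x / b))"
      using x l b by (intro C2) simp
    also have "\<dots> \<le> C2 * exp (\<epsilon> / 2 * x)"
      using C2 \<delta>l x by simp
    finally have "x powr (a - 1) * bessel_series a (l * x / b) \<le> (C1 * exp (\<epsilon> / 2 * x)) * (C2 * exp (\<epsilon> / 2 * x))"
      using C1 x a b l bessel_series_pos[of a "l * x / b"] by (intro mult_mono) auto
    also have "\<dots> = C1 * C2 * exp (\<epsilon> * x)"
      by (simp flip: exp_add)
    finally have "K * exp (- x / b) * (x powr (a - 1) * bessel_series a (l * x / b))
        \<le> K * exp (- x / b) * (C1 * C2 * exp (\<epsilon> * x))"
      using K by (intro mult_left_mono) auto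
    also have "\<dots> = K * (C1 * C2) * exp ((\<epsilon> - 1 / b) * x)"
      by (simp add: left_diff_distrib exp_diff exp_minus divide_inverse)
    finally show "ncgamma_density a b l x \<le> K * (C1 * C2) * exp ((\<epsilon> - 1 / b) * x)"
      by (simp add: ncgamma_density_eq[OF a b x(1)] K_def mult_ac)
  qed (use K C1 C2 in simp)
qed

text \<open>One term of the series suffices: for \<open>a > 1\<close> the term \<open>k = 0\<close>
  gives the exponent \<open>a - 1\<close>, otherwise \<open>l > 0\<close> and the term
  \<open>k = 1\<close> gives the exponent \<open>a\<close>.\<close>

lemma ncgamma_density_lower_bound:
  assumes a: "a > 0" and b: "b > 0" and l: "l \<ge> 0" and *: "l > 0 \<or> a > 1"
  obtains c s where "c > 0" "s > 0"
    "\<And>x. x > 0 \<Longrightarrow> c * x powr s * exp (- x / b) \<le> ncgamma_density a b l x"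
proof -
  obtain c s where c: "c > 0" "s > 0"
    and le: "\<And>x. x > 0 \<Longrightarrow> c * x powr s \<le> x powr (a - 1) * bessel_series a (l * x / b)"
  proof (cases "a > 1")
    case True
    show ?thesis
    proof (rule that[of "1 / Gamma a" "a - 1"])
      fix x :: real assume "x > 0"
      then show "1 / Gamma a * x powr (a - 1) \<le> x powr (a - 1) * bessel_series a (l * x / b)"
        using bessel_series_ge_term[OF a, of "l * x / b" 0] b l
        by (subst mult.commute) (intro mult_left_mono, auto)
    qed (use a True in simp_all)
  next
    case False
    with * have l: "l > 0" by simp
    show ?thesis
    proof (rule that[of "l / b / Gamma (a + 1)" a])
      fix x :: real assume x: "x > 0"
      have "l / b / Gamma (a + 1) * x powr a = x powr (a - 1) * (l * x / b / Gamma (a + 1))"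
        using x powr_add[of x "a - 1" 1] by simp
      also have "\<dots> \<le> x powr (a - 1) * bessel_series a (l * x / b)"
        using bessel_series_ge_term[OF a, of "l * x / b" 1] b l x by (intro mult_left_mono) auto
      finally show "l / b / Gamma (a + 1) * x powr a \<le> x powr (a - 1) * bessel_series a (l * x / b)" .
    qed (use a b l in simp_all)
  qed
  define K where "K = exp (- l) / b powr a"
  have K: "K > 0" unfolding K_def using b by simp
  show ?thesis
  proof (rule that[of "K * c" s])
    fix x :: real assume x: "x > 0"
    have "K * exp (- x / b) * (c * x powr s) \<le> K * exp (- x / b) * (x powr (a - 1) * bessel_series a (l * x / b))"
      using K le[OF x] by (intro mult_left_mono) auto
    then show "K * c * x powr s * exp (- x / b) \<le> ncgamma_density a b l x"
      by (simp add: ncgamma_density_eq[OF a b x] K_def mult_ac)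
  qed (use K c in simp_all)
qed

lemma central_ncgamma_density_eq:
  assumes "a > 0" "b > 0"
  obtains c where "c > 0" "\<And>x. x > 0 \<Longrightarrow> ncgamma_density a b 0 x = c * x powr (a - 1) * exp (- x / b)"
proof
  show "1 / b powr a * bessel_series a 0 > 0"
    using assms bessel_series_pos[of a 0] by simp
qed (use assms in \<open>simp add: ncgamma_density_eq\<close>)

subsection \<open>Log-convex and log-concave functions\<close>

text \<open>If \<open>L\<close> increased from \<open>x\<close> to \<open>y\<close>, the chord would
  have slope \<open>s > 0\<close>, and by convexity \<open>L\<close> would stay above its extension
  beyond \<open>y\<close>. This contradicts the growth bound with rate \<open>s / 2\<close>.\<close>

lemma convex_sublinear_antimono:
  fixes L :: "real \<Rightarrow> real"
  assumes conv: "convex_on {0<..} L"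
    and sub: "\<And>\<epsilon>. \<epsilon> > 0 \<Longrightarrow> \<exists>K. \<forall>x\<ge>1. L x \<le> K + \<epsilon> * x"
    and xy: "0 < x" "x \<le> y"
  shows "L y \<le> L x"
proof (rule ccontr)
  assume "\<not> L y \<le> L x"
  then have less: "L x < L y" by simp
  with xy have "x < y" by (cases "x = y") auto
  define s where "s = (L y - L x) / (y - x)"
  have s: "s > 0" unfolding s_def using less \<open>x < y\<close> by simp
  obtain K where K: "\<And>z. z \<ge> 1 \<Longrightarrow> L z \<le> K + s / 2 * z"
    using sub[of "s / 2"] s by auto
  \<comment> \<open>Beyond \<open>2 * (K + s * x - L x) / s\<close> the extended chord lies above
    the line \<open>K + s / 2 * z\<close>.\<close>
  define z where "z = max (y + 1) (max 1 (2 * (K + s * x - L x) / s + 1))"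
  have z: "z > y" "z \<ge> 1" "2 * (K + s * x - L x) / s < z"
    unfolding z_def by auto
  define u where "u = (y - x) / (z - x)"
  have u: "0 < u" "u < 1" unfolding u_def using \<open>x < y\<close> z by auto
  have "(1 - u) * x + u * z = x + u * (z - x)" by (simp add: algebra_simps)
  also have "\<dots> = y" unfolding u_def using \<open>x < y\<close> z by simp
  finally have "L y \<le> (1 - u) * L x + u * L z"
    using convex_onD[OF conv, of u x z] u xy z by simp
  then have "L y - L x \<le> u * (L z - L x)" by (simp add: algebra_simps)
  moreover have "L y - L x = s * (z - x) * u"
    unfolding s_def u_def using \<open>x < y\<close> z by simp
  ultimately have "s * (z - x) \<le> L z - L x"
    using u by (simp add: mult.commute)
  also have "\<dots> \<le> K + s / 2 * z - L x" using K z by simp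
  finally have "s * z \<le> 2 * (K + s * x - L x)" by (simp add: algebra_simps)
  with z(3) s show False by (simp add: divide_less_eq mult.commute)
qed

text \<open>The linear term does not affect convexity; with \<open>c = 1 / b1\<close> it accounts
  for the exponential tilt.\<close>

lemma log_convex_onD:
  assumes "log_convex_on I h"
  shows "convex_on I (\<lambda>x. ln (enn2real (h x)) + c * x)"
proof (rule convex_onI)
  fix t x y :: real assume t: "0 < t" "t < 1" and xy: "x \<in> I" "y \<in> I"
  have I: "is_interval I" and pos: "\<And>x. x \<in> I \<Longrightarrow> 0 < enn2real (h x)"
    using assms unfolding log_convex_on_def by (auto simp: enn2real_positive_iff)
  \<comment> \<open>Convexity is tested with weight \<open>1 - t\<close> at \<open>x\<close>,
    whereas \<open>log_convex_on_def\<close> puts weight \<open>t\<close> there.\<close>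
  have "1 - t \<in> {0..1}" using t by simp
  with assms xy have le: "enn2real (h ((1 - t) * x + (1 - (1 - t)) * y)) \<le>
      enn2real (h x) powr (1 - t) * enn2real (h y) powr (1 - (1 - t))"
    unfolding log_convex_on_def by blast
  have "(1 - t) * x + t * y \<in> I"
    using convexD_alt[of I x y t] I xy t by (simp add: is_interval_convex_1)
  then have z: "0 < enn2real (h ((1 - t) * x + t * y))" by (rule pos)
  have "ln (enn2real (h ((1 - t) * x + (1 - (1 - t)) * y))) \<le>
      ln (enn2real (h x) powr (1 - t) * enn2real (h y) powr (1 - (1 - t)))"
    using le z by (subst ln_le_cancel_iff) auto
  also have "\<dots> = (1 - t) * ln (enn2real (h x)) + (1 - (1 - t)) * ln (enn2real (h y))"
    using pos xy by (intro ln_geometric_mean) auto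
  finally show "ln (enn2real (h ((1 - t) *\<^sub>R x + t *\<^sub>R y))) + c * ((1 - t) *\<^sub>R x + t *\<^sub>R y)
      \<le> (1 - t) * (ln (enn2real (h x)) + c * x) + t * (ln (enn2real (h y)) + c * y)"
    by (simp add: algebra_simps)
qed (use assms in \<open>simp add: log_convex_on_def is_interval_convex_1\<close>)

text \<open>The negated form lets \<open>convex_sublinear_antimono\<close> serve the log-concave
  case too.\<close>

lemma log_concave_onD:
  assumes "log_concave_on I h"
  shows "convex_on I (\<lambda>x. - (ln (enn2real (h x)) + c * x))"
proof (rule convex_onI)
  fix t x y :: real assume t: "0 < t" "t < 1" and xy: "x \<in> I" "y \<in> I"
  have I: "is_interval I" and pos: "\<And>x. x \<in> I \<Longrightarrow> 0 < enn2real (h x)"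
    using assms unfolding log_concave_on_def by (auto simp: enn2real_positive_iff)
  have "1 - t \<in> {0..1}" using t by simp
  with assms xy have le: "enn2real (h x) powr (1 - t) * enn2real (h y) powr (1 - (1 - t)) \<le>
      enn2real (h ((1 - t) * x + (1 - (1 - t)) * y))"
    unfolding log_concave_on_def by blast
  have "(1 - t) * x + t * y \<in> I"
    using convexD_alt[of I x y t] I xy t by (simp add: is_interval_convex_1)
  then have z: "0 < enn2real (h ((1 - t) * x + t * y))" by (rule pos)
  have "(1 - t) * ln (enn2real (h x)) + (1 - (1 - t)) * ln (enn2real (h y)) =
      ln (enn2real (h x) powr (1 - t) * enn2real (h y) powr (1 - (1 - t)))"
    using pos xy by (intro ln_geometric_mean[symmetric]) auto
  also have "\<dots> \<le> ln (enn2real (h ((1 - t) * x + (1 - (1 - t)) * y)))"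
    using le z pos[OF xy(1)] pos[OF xy(2)] by (subst ln_le_cancel_iff) auto
  finally show "- (ln (enn2real (h ((1 - t) *\<^sub>R x + t *\<^sub>R y))) + c * ((1 - t) *\<^sub>R x + t *\<^sub>R y))
      \<le> (1 - t) * - (ln (enn2real (h x)) + c * x) + t * - (ln (enn2real (h y)) + c * y)"
    by (simp add: algebra_simps)
qed (use assms in \<open>simp add: log_concave_on_def is_interval_convex_1\<close>)

section \<open>Reflection at the origin\<close>

lemma log_convex_on_reflect:
  assumes "log_convex_on I h"
  shows "log_convex_on (uminus ` I) (\<lambda>x. h (- x))"
proof -
  have "is_interval (uminus ` I)"
    using assms by (simp add: log_convex_on_def)
  moreover have "- (t * - x + (1 - t) * - y) = t * x + (1 - t) * y" for t x y :: real
    by (simp add: algebra_simps)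
  ultimately show ?thesis
    using assms unfolding log_convex_on_def by (simp add: add.commute)
qed

lemma log_concave_on_reflect:
  assumes "log_concave_on I h"
  shows "log_concave_on (uminus ` I) (\<lambda>x. h (- x))"
proof -
  have "is_interval (uminus ` I)"
    using assms by (simp add: log_concave_on_def)
  moreover have "- (t * - x + (1 - t) * - y) = t * x + (1 - t) * y" for t x y :: real
    by (simp add: algebra_simps)
  ultimately show ?thesis
    using assms unfolding log_concave_on_def by (simp add: add.commute)
qed

subsection \<open>The density of the difference\<close>

text \<open>The normalisation \<open>total\<close> is supplied in \<open>theorem2p3\<close> by
  \<open>G2\<close> having this density. Half-line results are proved for positive \<open>x\<close>
  only; a second interpretation with the variables exchanged gives the negative side.\<close>

locale ncgamma_difference =
  fixes a1 b1 l1 a2 b2 l2 :: real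
  assumes a1: "a1 > 0" and b1: "b1 > 0" and l1: "l1 \<ge> 0"
    and a2: "a2 > 0" and b2: "b2 > 0" and l2: "l2 \<ge> 0"
    and total: "(\<integral>\<^sup>+y. ennreal (ncgamma_density a2 b2 l2 y) \<partial>lborel) = 1"
begin

abbreviation "f \<equiv> ncgamma_density a1 b1 l1"
abbreviation "g \<equiv> ncgamma_density a2 b2 l2"
abbreviation "p \<equiv> ncgamma_diff_density a1 b1 l1 a2 b2 l2"

lemmas f_pos = ncgamma_density_pos[OF a1 b1 l1] and f_nonneg = ncgamma_density_nonneg[OF a1 b1 l1]
lemmas g_pos = ncgamma_density_pos[OF a2 b2 l2] and g_nonneg = ncgamma_density_nonneg[OF a2 b2 l2]

text \<open>Both densities vanish at nonpositive arguments, so the integral may be taken over the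
  whole line.\<close>

lemma diff_density_eq: "p x = (\<integral>\<^sup>+y. ennreal (f (x + y) * g y) \<partial>lborel)"
  unfolding ncgamma_diff_density_def
  by (intro nn_integral_cong)
    (auto simp: indicator_def ncgamma_density_nonpos ennreal_mult f_nonneg g_nonneg not_less max_def split: if_splits)

lemma diff_density_pos: "p x > 0"
proof (rule ccontr)
  \<comment> \<open>Just above the lower limit \<open>m\<close> of the convolution integral, on an
    interval of length 1, both factors are positive.\<close>
  define m where "m = max 0 (- x)"
  assume "\<not> p x > 0"
  then have "emeasure lborel {y. f (x + y) * g y > 0} = 0"
    by (subst (asm) diff_density_eq, subst (asm) not_gr_zero, subst (asm) nn_integral_0_iff) (auto simp: ennreal_eq_0_iff not_le)
  moreover have "emeasure lborel {m<..<m + 1} \<le> emeasure lborel {y. f (x + y) * g y > 0}"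
    unfolding m_def by (intro emeasure_mono) (auto intro!: mult_pos_pos f_pos g_pos)
  ultimately show False by simp
qed

text \<open>\<open>p x\<close> is the average of \<open>f (x + y)\<close> with respect to the
  probability density \<open>g\<close>.\<close>

lemma diff_density_le:
  assumes "c \<ge> 0" "\<And>y. y > 0 \<Longrightarrow> f (x + y) \<le> c"
  shows "p x \<le> ennreal c"
proof -
  have "p x \<le> (\<integral>\<^sup>+y. ennreal c * ennreal (g y) \<partial>lborel)"
    unfolding diff_density_eq
  proof (intro nn_integral_mono)
    fix y
    have "f (x + y) * g y \<le> c * g y"
      using assms g_nonneg[of y] ncgamma_density_nonpos[of y a2 b2 l2]
      by (cases "y > 0") (auto intro: mult_right_mono)
    then show "ennreal (f (x + y) * g y) \<le> ennreal c * ennreal (g y)"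
      using assms(1) by (simp flip: ennreal_mult add: g_nonneg ennreal_leI)
  qed
  also have "\<dots> = ennreal c" by (simp add: nn_integral_cmult total)
  finally show ?thesis .
qed

text \<open>\<open>W\<close> is the Laplace transform of \<open>g\<close> at
  \<open>\<kappa>\<close>, which is positive, finite and independent of \<open>x\<close> and
  \<open>c\<close>.\<close>

lemma diff_density_ge:
  assumes "\<kappa> \<ge> 0"
  obtains W where "W > 0"
    "\<And>x c. c \<ge> 0 \<Longrightarrow> (\<And>y. y > 0 \<Longrightarrow> c * exp (- \<kappa> * y) \<le> f (x + y)) \<Longrightarrow> ennreal (c * W) \<le> p x"
proof -
  let ?W = "\<integral>\<^sup>+y. ennreal (exp (- \<kappa> * y) * g y) \<partial>lborel"
  have "exp (- \<kappa> * y) * g y \<le> g y" for y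
    using assms g_nonneg[of y] ncgamma_density_nonpos[of y a2 b2 l2]
    by (cases "y > 0") (auto intro: mult_left_le_one_le)
  then have "?W \<le> (\<integral>\<^sup>+y. ennreal (g y) \<partial>lborel)"
    by (intro nn_integral_mono ennreal_leI)
  then have fin: "?W < \<infinity>" by (simp add: total le_less_trans)
  have "?W \<noteq> 0"
  proof
    assume "?W = 0"
    then have "AE y in lborel. ennreal (g y) = 0"
      by (subst (asm) nn_integral_0_iff_AE) (auto simp: ennreal_eq_0_iff mult_le_0_iff)
    then have "(\<integral>\<^sup>+y. ennreal (g y) \<partial>lborel) = 0"
      by (subst nn_integral_0_iff_AE) auto
    with total show False by simp
  qed
  then have W: "enn2real ?W > 0" using fin by (simp add: enn2real_positive_iff zero_less_iff_neq_zero)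
  show ?thesis
  proof (rule that[OF W])
    fix x c :: real assume c: "c \<ge> 0" and le: "\<And>y. y > 0 \<Longrightarrow> c * exp (- \<kappa> * y) \<le> f (x + y)"
    have "ennreal (c * enn2real ?W) = ennreal c * ?W"
      using fin c by (simp add: ennreal_mult)
    also have "\<dots> = (\<integral>\<^sup>+y. ennreal c * ennreal (exp (- \<kappa> * y) * g y) \<partial>lborel)"
      by (simp add: nn_integral_cmult)
    also have "\<dots> \<le> p x"
      unfolding diff_density_eq
    proof (intro nn_integral_mono)
      fix y
      have "c * exp (- \<kappa> * y) * g y \<le> f (x + y) * g y"
        using le[of y] g_nonneg[of y] ncgamma_density_nonpos[of y a2 b2 l2]
        by (cases "y > 0") (auto intro: mult_right_mono)
      then show "ennreal c * ennreal (exp (- \<kappa> * y) * g y) \<le> ennreal (f (x + y) * g y)"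
        using c by (simp flip: ennreal_mult add: g_nonneg ennreal_leI mult.assoc)
    qed
    finally show "ennreal (c * enn2real ?W) \<le> p x" .
  qed
qed

lemma diff_density_finite:
  assumes "x > 0 \<or> a1 \<ge> 1"
  shows "p x < \<infinity>"
proof -
  \<comment> \<open>With \<open>\<epsilon> = 1 / b1\<close> the exponent vanishes and the bound on
    \<open>f\<close> is a constant.\<close>
  obtain C where C: "C > 0" "\<And>z. z > 0 \<Longrightarrow> z \<ge> x \<Longrightarrow> f z \<le> C * exp ((1 / b1 - 1 / b1) * z)"
    using ncgamma_density_upper_bound[OF a1 b1 l1, of "1 / b1" x] assms b1 by auto
  then have "p x \<le> ennreal C"
  proof (intro diff_density_le)
    fix y :: real assume "y > 0"
    then show "f (x + y) \<le> C"
      using C(1) C(2)[of "x + y"] ncgamma_density_nonpos[of "x + y" a1 b1 l1] by (cases "x + y > 0") auto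
  qed simp
  then show ?thesis by (rule le_less_trans) simp
qed

lemma diff_density_real:
  assumes "x > 0 \<or> a1 \<ge> 1"
  shows "p x = ennreal (enn2real (p x))" "enn2real (p x) > 0"
  using diff_density_finite[OF assms] diff_density_pos[of x] by (auto simp: enn2real_positive_iff)

section \<open>Growth of the tilted density\<close>

abbreviation "log_tilt x \<equiv> ln (enn2real (p x)) + 1 / b1 * x"

lemma log_tilt_le:
  assumes x: "x > 0" and C: "C > 0" and le: "p x \<le> ennreal (C * exp (\<kappa> * x))"
  shows "log_tilt x \<le> ln C + (\<kappa> + 1 / b1) * x"
proof -
  have "enn2real (p x) \<le> C * exp (\<kappa> * x)"
    using le C by (intro enn2real_leI) auto
  then have "ln (enn2real (p x)) \<le> ln (C * exp (\<kappa> * x))"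
    using diff_density_real(2)[of x] x C by (subst ln_le_cancel_iff) auto
  then show ?thesis
    using C by (simp add: ln_mult algebra_simps)
qed

lemma log_tilt_ge:
  assumes x: "x > 0" and c: "c > 0" and le: "ennreal (c * exp (\<kappa> * x)) \<le> p x"
  shows "ln c + (\<kappa> + 1 / b1) * x \<le> log_tilt x"
proof -
  have "c * exp (\<kappa> * x) \<le> enn2real (p x)"
    using le c diff_density_real[of x] x by (metis disjI1 ennreal_le_iff less_imp_le)
  then have "ln (c * exp (\<kappa> * x)) \<le> ln (enn2real (p x))"
    using diff_density_real(2)[of x] x c by (subst ln_le_cancel_iff) auto
  then show ?thesis
    using c by (simp add: ln_mult algebra_simps)
qed

lemma log_tilt_sublinear:
  assumes "\<epsilon> > 0"
  shows "\<exists>K. \<forall>x\<ge>1. log_tilt x \<le> K + \<epsilon> * x"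
proof -
  \<comment> \<open>Capping the rate at \<open>1 / b1\<close> keeps the exponential bound
    nonincreasing, so its value at \<open>x + y\<close> is at most that at \<open>x\<close>.\<close>
  define \<delta> where "\<delta> = min \<epsilon> (1 / b1)"
  have \<delta>: "\<delta> > 0" "\<delta> \<le> \<epsilon>" "\<delta> - 1 / b1 \<le> 0" unfolding \<delta>_def using assms b1 by auto
  obtain C where C: "C > 0" "\<And>z. z > 0 \<Longrightarrow> z \<ge> 1 \<Longrightarrow> f z \<le> C * exp ((\<delta> - 1 / b1) * z)"
    using ncgamma_density_upper_bound[OF a1 b1 l1 \<delta>(1), of 1] by auto
  have "log_tilt x \<le> ln C + \<epsilon> * x" if x: "x \<ge> 1" for x
  proof -
    have "p x \<le> ennreal (C * exp ((\<delta> - 1 / b1) * x))"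
    proof (intro diff_density_le)
      fix y :: real assume y: "y > 0"
      have "f (x + y) \<le> C * exp ((\<delta> - 1 / b1) * (x + y))" using C x y by simp
      also have "\<dots> \<le> C * exp ((\<delta> - 1 / b1) * x)"
        using C y \<delta> by (simp add: mult_left_mono_neg)
      finally show "f (x + y) \<le> C * exp ((\<delta> - 1 / b1) * x)" .
    qed (use C in simp)
    then have "log_tilt x \<le> ln C + (\<delta> - 1 / b1 + 1 / b1) * x"
      using x C by (intro log_tilt_le) auto
    also have "\<dots> \<le> ln C + \<epsilon> * x" using \<delta> x by (simp add: mult_right_mono)
    finally show ?thesis .
  qed
  then show ?thesis by blast
qed

lemma log_convex_imp:
  assumes "log_convex_on {0<..} p"
  shows "l1 = 0 \<and> a1 \<le> 1"
proof (rule ccontr)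
  assume "\<not> (l1 = 0 \<and> a1 \<le> 1)"
  with l1 have "l1 > 0 \<or> a1 > 1" by auto
  then obtain c s where c: "c > 0" "s > 0"
    and ge: "\<And>x. x > 0 \<Longrightarrow> c * x powr s * exp (- x / b1) \<le> f x"
    using ncgamma_density_lower_bound[OF a1 b1 l1] by blast
  obtain W where W: "W > 0" "\<And>x c. c \<ge> 0 \<Longrightarrow>
      (\<And>y. y > 0 \<Longrightarrow> c * exp (- (1 / b1) * y) \<le> f (x + y)) \<Longrightarrow> ennreal (c * W) \<le> p x"
    using diff_density_ge[of "1 / b1"] b1 by auto
  have lower: "ln (c * W) + s * ln x \<le> log_tilt x" if x: "x > 0" for x
  proof -
    have "ennreal (c * x powr s * exp (- x / b1) * W) \<le> p x"
    proof (rule W(2))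
      fix y :: real assume y: "y > 0"
      have "c * x powr s * exp (- x / b1) * exp (- (1 / b1) * y) = c * x powr s * exp (- (x + y) / b1)"
        by (simp add: mult.assoc add_divide_distrib diff_divide_distrib flip: exp_add)
      also have "\<dots> \<le> c * (x + y) powr s * exp (- (x + y) / b1)"
        using c x y by (intro mult_right_mono mult_left_mono powr_mono2) auto
      also have "\<dots> \<le> f (x + y)" using x y by (intro ge) simp
      finally show "c * x powr s * exp (- x / b1) * exp (- (1 / b1) * y) \<le> f (x + y)" .
    qed (use c in simp)
    then have "ln (c * W * x powr s) + (- (1 / b1) + 1 / b1) * x \<le> log_tilt x"
      using c W x by (intro log_tilt_ge) (auto simp: mult_ac)
    then show ?thesis using c W x by (simp add: ln_mult ln_powr)
  qed
  \<comment> \<open>Here \<open>s * ln x\<close> is large enough for the lower bound to exceed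
    \<open>log_tilt 1\<close>; the \<open>max\<close> ensures \<open>x \<ge> 1\<close>.\<close>
  define x where "x = exp (max 0 ((log_tilt 1 - ln (c * W)) / s + 1))"
  have "x \<ge> 1" unfolding x_def by simp
  have "(log_tilt 1 - ln (c * W)) / s < ln x" unfolding x_def by simp
  then have "log_tilt 1 < ln (c * W) + s * ln x"
    using c by (simp add: divide_less_eq algebra_simps)
  also have "\<dots> \<le> log_tilt x" using \<open>x \<ge> 1\<close> by (intro lower) simp
  also have "\<dots> \<le> log_tilt 1"
    using convex_sublinear_antimono[OF log_convex_onD[OF assms, of "1 / b1"] log_tilt_sublinear, of 1 x]
      \<open>x \<ge> 1\<close> by simp
  finally show False by simp
qed

text \<open>This is Hoelder's inequality: the weighted AM-GM inequality is applied to the integrands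
  divided by \<open>U = p x\<close> and \<open>V = p y\<close>, whose integrals are 1, so the bound
  integrates to \<open>H * (t + (1 - t)) = H\<close>.\<close>

lemma log_convex_if:
  assumes l: "l1 = 0" and a: "a1 \<le> 1"
  shows "log_convex_on {0<..} p"
  unfolding log_convex_on_def
proof (intro conjI ballI)
  fix x y t :: real assume x: "x \<in> {0<..}" and y: "y \<in> {0<..}" and t: "t \<in> {0..1}"
  let ?z = "t * x + (1 - t) * y"
  define U where "U = enn2real (p x)"
  define V where "V = enn2real (p y)"
  define H where "H = U powr t * V powr (1 - t)"
  have U: "p x = ennreal U" "U > 0" and V: "p y = ennreal V" "V > 0"
    unfolding U_def V_def using diff_density_real x y by auto
  have H: "H > 0" unfolding H_def using U V by simp
  have "f (?z + s) * g s \<le> H * t / U * (f (x + s) * g s) + H * (1 - t) / V * (f (y + s) * g s)" for s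
  proof (cases "s > 0")
    case True
    have pos: "f (x + s) > 0" "f (y + s) > 0"
      using True x y by (auto intro!: f_pos)
    have "?z + s = t * (x + s) + (1 - t) * (y + s)" by (simp add: algebra_simps)
    then have "f (?z + s) \<le> f (x + s) powr t * f (y + s) powr (1 - t)"
      using central_ncgamma_density_log_convex[OF a1 a b1, of t "x + s" "y + s"] True x y t l by simp
    also have "\<dots> = H * ((f (x + s) / U) powr t * (f (y + s) / V) powr (1 - t))"
      unfolding H_def using U V pos by (simp add: powr_divide)
    also have "\<dots> \<le> H * (t * (f (x + s) / U) + (1 - t) * (f (y + s) / V))"
      using H t U V pos by (intro mult_left_mono Youngs_inequality_0) auto
    finally have "f (?z + s) * g s \<le> H * (t * (f (x + s) / U) + (1 - t) * (f (y + s) / V)) * g s"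
      using g_nonneg by (intro mult_right_mono)
    then show ?thesis by (simp add: algebra_simps)
  qed (simp add: ncgamma_density_nonpos)
  then have "p ?z \<le> (\<integral>\<^sup>+s. ennreal (H * t / U * (f (x + s) * g s) + H * (1 - t) / V * (f (y + s) * g s)) \<partial>lborel)"
    unfolding diff_density_eq by (intro nn_integral_mono ennreal_leI)
  also have "\<dots> = (\<integral>\<^sup>+s. ennreal (H * t / U) * ennreal (f (x + s) * g s) +
      ennreal (H * (1 - t) / V) * ennreal (f (y + s) * g s) \<partial>lborel)"
    using H U V t f_nonneg g_nonneg by (intro nn_integral_cong) (simp flip: ennreal_mult ennreal_plus)
  also have "\<dots> = ennreal (H * t / U) * p x + ennreal (H * (1 - t) / V) * p y"
    unfolding diff_density_eq by (simp add: nn_integral_add nn_integral_cmult)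
  also have "\<dots> = ennreal (H * t / U * U + H * (1 - t) / V * V)"
    unfolding U V using H U V t by (subst ennreal_plus) (simp_all add: ennreal_mult[symmetric])
  also have "H * t / U * U + H * (1 - t) / V * V = H"
    using U V by (simp add: field_simps)
  finally show "enn2real (p ?z) \<le> enn2real (p x) powr t * enn2real (p y) powr (1 - t)"
    using H by (fold U_def V_def H_def) (simp add: enn2real_leI)
qed (auto simp: diff_density_pos diff_density_finite[simplified] is_interval_convex_1)

text \<open>The integrand \<open>f (x + s) * g s\<close> is jointly log-concave in \<open>x\<close>
  and \<open>s\<close>, and Prekopa-Leindler integrates out \<open>s\<close>. The condition on
  \<open>a1\<close> also makes \<open>p\<close> finite at 0.\<close>

lemma log_concave_if:
  assumes a: "a1 \<ge> 1" "a2 \<ge> 1"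
  shows "log_concave_on UNIV p"
  unfolding log_concave_on_def
proof (intro conjI ballI)
  fix x y t :: real assume t: "t \<in> {0..1}"
  let ?z = "t * x + (1 - t) * y"
  note real = diff_density_real[OF disjI2[OF a(1)]]
  obtain F where F: "F > 0" "\<And>x. x > 0 \<Longrightarrow> f x \<le> F"
    using ncgamma_density_upper_bound[OF a1 b1 l1, of "1 / b1" 0] a b1 by auto
  obtain G where G: "G > 0" "\<And>x. x > 0 \<Longrightarrow> g x \<le> G"
    using ncgamma_density_upper_bound[OF a2 b2 l2, of "1 / b2" 0] a b2 by auto
  have F': "f x \<le> F" and G': "g x \<le> G" for x
    using F(1) F(2)[of x] G(1) G(2)[of x] by (auto simp: ncgamma_density_def)
  have bdd: "bdd_above (range (\<lambda>s. f (x + s) * g s))" for x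
    using F(1) F' G' f_nonneg g_nonneg by (intro bdd_aboveI2[where M = "F * G"] mult_mono) auto
  consider "t = 0" | "t = 1" | "0 < t" "t < 1" using t by fastforce
  then show "enn2real (p ?z) \<ge> enn2real (p x) powr t * enn2real (p y) powr (1 - t)"
  proof cases
    case 3
    have "ennreal (enn2real (p x) powr t * enn2real (p y) powr (1 - t)) \<le>
        (\<integral>\<^sup>+s. ennreal (f (?z + s) * g s) \<partial>lborel)"
    proof (rule prekopa_leindler[where f = "\<lambda>s. f (x + s) * g s" and g = "\<lambda>s. f (y + s) * g s"])
      fix r s
      have "(f (x + r) * g r) powr t * (f (y + s) * g s) powr (1 - t) =
          (f (x + r) powr t * f (y + s) powr (1 - t)) * (g r powr t * g s powr (1 - t))"
        by (simp add: powr_mult f_nonneg g_nonneg)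
      also have "\<dots> \<le> f (t * (x + r) + (1 - t) * (y + s)) * g (t * r + (1 - t) * s)"
        using a b1 b2 l1 l2 3 by (intro mult_mono ncgamma_density_log_concave f_nonneg) auto
      also have "t * (x + r) + (1 - t) * (y + s) = ?z + (t * r + (1 - t) * s)"
        by (simp add: algebra_simps)
      finally show "(f (x + r) * g r) powr t * (f (y + s) * g s) powr (1 - t) \<le>
          f (?z + (t * r + (1 - t) * s)) * g (t * r + (1 - t) * s)" .
    qed (use 3 real bdd f_nonneg g_nonneg in \<open>simp_all flip: diff_density_eq\<close>)
    also have "\<dots> = ennreal (enn2real (p ?z))"
      using real(1)[of ?z] by (simp flip: diff_density_eq)
    finally show ?thesis by simp
  qed (use real(2)[of x] real(2)[of y] in simp_all)
qed (use a in \<open>auto simp: diff_density_pos diff_density_finite[simplified]\<close>)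

lemma log_concave_imp:
  assumes lc: "log_concave_on UNIV p" and l: "l1 = 0"
  shows "a1 \<ge> 1"
proof (rule ccontr)
  assume "\<not> a1 \<ge> 1"
  then have a: "a1 < 1" by simp
  obtain c where c: "c > 0" and eq: "\<And>x. x > 0 \<Longrightarrow> f x = c * x powr (a1 - 1) * exp (- x / b1)"
    using central_ncgamma_density_eq[OF a1 b1] l by blast
  \<comment> \<open>For \<open>a1 < 1\<close> the power decreases, so \<open>f (x + y)\<close> is
    largest as \<open>y\<close> tends to 0.\<close>
  have upper: "log_tilt x \<le> ln c + (a1 - 1) * ln x" if x: "x > 0" for x
  proof -
    have "p x \<le> ennreal (c * x powr (a1 - 1) * exp (- (1 / b1) * x))"
    proof (intro diff_density_le)
      fix y :: real assume y: "y > 0"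
      have "f (x + y) = c * (x + y) powr (a1 - 1) * exp (- (x + y) / b1)"
        using x y by (intro eq) simp
      also have "\<dots> \<le> c * x powr (a1 - 1) * exp (- (1 / b1) * x)"
        using c x y a b1 by (intro mult_mono powr_mono2') (auto simp: field_simps)
      finally show "f (x + y) \<le> c * x powr (a1 - 1) * exp (- (1 / b1) * x)" .
    qed (use c in simp)
    then have "log_tilt x \<le> ln (c * x powr (a1 - 1)) + (- (1 / b1) + 1 / b1) * x"
      using c x by (intro log_tilt_le) auto
    then show ?thesis using c x by (simp add: ln_mult ln_powr)
  qed
  \<comment> \<open>Bounding the decaying power below by a multiple of
    \<open>exp (- \<epsilon> * x)\<close> makes the lower bound on \<open>f\<close> purely
    exponential, so that its dependence on \<open>y\<close> separates with rate
    \<open>\<epsilon> + 1 / b1\<close>.\<close>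
  have sub: "\<exists>K. \<forall>x\<ge>1. - log_tilt x \<le> K + \<epsilon> * x" if \<epsilon>: "\<epsilon> > 0" for \<epsilon>
  proof -
    obtain C where C: "C > 0" "\<And>x. x > 0 \<Longrightarrow> x powr (1 - a1) \<le> C * exp (\<epsilon> * x)"
      using powr_subexponential[of "1 - a1" \<epsilon>] a \<epsilon> by (metis diff_ge_0_iff_ge less_imp_le)
    obtain W where W: "W > 0" "\<And>x c. c \<ge> 0 \<Longrightarrow>
        (\<And>y. y > 0 \<Longrightarrow> c * exp (- (\<epsilon> + 1 / b1) * y) \<le> f (x + y)) \<Longrightarrow> ennreal (c * W) \<le> p x"
      using diff_density_ge[of "\<epsilon> + 1 / b1"] b1 \<epsilon> by auto
    have "- log_tilt x \<le> - ln (c / C * W) + \<epsilon> * x" if x: "x \<ge> 1" for x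
    proof -
      have "ennreal (c / C * exp (- (\<epsilon> + 1 / b1) * x) * W) \<le> p x"
      proof (rule W(2))
        fix y :: real assume y: "y > 0"
        have "1 / C * exp (- \<epsilon> * (x + y)) = 1 / (C * exp (\<epsilon> * (x + y)))"
          by (simp add: exp_minus divide_inverse)
        also have "\<dots> \<le> 1 / (x + y) powr (1 - a1)"
          using C(1) C(2)[of "x + y"] x y by (intro divide_left_mono) auto
        also have "\<dots> = (x + y) powr (a1 - 1)"
          using powr_minus[of "x + y" "1 - a1"] by (simp add: divide_inverse)
        finally have "1 / C * exp (- \<epsilon> * (x + y)) \<le> (x + y) powr (a1 - 1)" .
        then have "c * (1 / C * exp (- \<epsilon> * (x + y))) * exp (- (x + y) / b1)
            \<le> c * (x + y) powr (a1 - 1) * exp (- (x + y) / b1)"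
          using c by (intro mult_right_mono mult_left_mono) auto
        also have "\<dots> = f (x + y)" using x y by (intro eq[symmetric]) simp
        also have "c * (1 / C * exp (- \<epsilon> * (x + y))) * exp (- (x + y) / b1) =
            c / C * exp (- (\<epsilon> + 1 / b1) * x) * exp (- (\<epsilon> + 1 / b1) * y)"
          by (simp add: mult.assoc algebra_simps add_divide_distrib diff_divide_distrib flip: exp_add)
        finally show "c / C * exp (- (\<epsilon> + 1 / b1) * x) * exp (- (\<epsilon> + 1 / b1) * y) \<le> f (x + y)" .
      qed (use c C in simp)
      then have "ln (c / C * W) + (- (\<epsilon> + 1 / b1) + 1 / b1) * x \<le> log_tilt x"
        using c C W x by (intro log_tilt_ge) (auto simp: mult_ac)
      then show ?thesis by simp
    qed
    then show ?thesis by blast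
  qed
  \<comment> \<open>Since \<open>a1 - 1 < 0\<close>, multiplying the lower bound on
    \<open>ln x\<close> by it reverses the inequality, and the upper bound at \<open>x\<close> falls
    below \<open>log_tilt 1\<close>.\<close>
  define x where "x = exp (max 0 ((log_tilt 1 - ln c) / (a1 - 1) + 1))"
  have "x \<ge> 1" unfolding x_def by simp
  have "(log_tilt 1 - ln c) / (a1 - 1) < ln x" unfolding x_def by simp
  then have "ln c + (a1 - 1) * ln x < log_tilt 1"
    using a by (simp add: divide_less_eq algebra_simps)
  moreover have "log_tilt x \<le> ln c + (a1 - 1) * ln x" using \<open>x \<ge> 1\<close> by (intro upper) simp
  moreover have "- log_tilt x \<le> - log_tilt 1"
    using convex_sublinear_antimono[OF convex_on_subset[OF log_concave_onD[OF lc, of "1 / b1"]] sub, of 1 x]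
      \<open>x \<ge> 1\<close> by simp
  ultimately show False by simp
qed

end

text \<open>Shifting the integration variable by \<open>x\<close> exchanges the densities. The
  identity holds at every point, including 0, where both sides may be infinite.\<close>

lemma ncgamma_diff_density_reflect:
  "ncgamma_diff_density a1 b1 l1 a2 b2 l2 (- x) = ncgamma_diff_density a2 b2 l2 a1 b1 l1 x"
proof -
  let ?f = "\<lambda>x. ennreal (ncgamma_density a1 b1 l1 x)" and ?g = "\<lambda>x. ennreal (ncgamma_density a2 b2 l2 x)"
  have "ncgamma_diff_density a1 b1 l1 a2 b2 l2 (- x) = (\<integral>\<^sup>+y. ?f (- x + y) * ?g y \<partial>lborel)"
    unfolding ncgamma_diff_density_def
    by (intro nn_integral_cong) (auto simp: indicator_def ncgamma_density_nonpos not_less max_def split: if_splits)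
  also have "\<dots> = (\<integral>\<^sup>+y. ?g (x + y) * ?f y \<partial>lborel)"
    by (subst nn_integral_real_affine[where c = 1 and t = x]) (simp_all add: mult.commute)
  also have "\<dots> = ncgamma_diff_density a2 b2 l2 a1 b1 l1 x"
    unfolding ncgamma_diff_density_def
    by (intro nn_integral_cong) (auto simp: indicator_def ncgamma_density_nonpos not_less max_def split: if_splits)
  finally show ?thesis .
qed

lemma (in prob_space) distributed_nn_integral_total:
  assumes "distributed M N X h"
  shows "(\<integral>\<^sup>+x. h x \<partial>N) = 1"
  using distributed_nn_integral[OF assms, of "\<lambda>_. 1"] by (simp add: emeasure_space_1)

theorem theorem2p3:
  fixes M :: "'a measure" and G1 G2 :: "'a \<Rightarrow> real"
    and a1 a2 b1 b2 l1 l2 :: real and p :: "real \<Rightarrow> ennreal"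
  assumes "a1 > 0" and "a2 > 0" and "b1 > 0" and "b2 > 0" and "l1 \<ge> 0" and "l2 \<ge> 0"
    and "prob_space M"
    and "distributed M lborel G1 (\<lambda>x. ennreal (ncgamma_density a1 b1 l1 x))"
    and "distributed M lborel G2 (\<lambda>x. ennreal (ncgamma_density a2 b2 l2 x))"
    and "prob_space.indep_var M borel G1 borel G2"
    and "distributed M lborel (\<lambda>\<omega>. G1 \<omega> - G2 \<omega>) p"
    and "p = ncgamma_diff_density a1 b1 l1 a2 b2 l2"
  shows "(log_convex_on {0<..} p \<longleftrightarrow> l1 = 0 \<and> a1 \<le> 1) \<and>
         (log_convex_on {..<0} p \<longleftrightarrow> l2 = 0 \<and> a2 \<le> 1) \<and>
         (a1 \<ge> 1 \<and> a2 \<ge> 1 \<longrightarrow> log_concave_on UNIV p) \<and>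
         (l1 = 0 \<and> l2 = 0 \<longrightarrow> (log_concave_on UNIV p \<longleftrightarrow> a1 \<ge> 1 \<and> a2 \<ge> 1))"
proof -
  interpret prob_space M by fact
  interpret D: ncgamma_difference a1 b1 l1 a2 b2 l2
    using assms distributed_nn_integral_total by unfold_locales auto
  interpret R: ncgamma_difference a2 b2 l2 a1 b1 l1
    using assms distributed_nn_integral_total by unfold_locales auto
  let ?q = "ncgamma_diff_density a2 b2 l2 a1 b1 l1"
  have refl: "(\<lambda>x. p (- x)) = ?q" "(\<lambda>x. ?q (- x)) = p"
    unfolding assms(12) by (simp_all add: ncgamma_diff_density_reflect)
  have uminus_image: "uminus ` {0<..} = {..<(0::real)}" "uminus ` {..<0} = {(0::real)<..}"
    by (auto simp: image_iff intro: bexI[of _ "- _"])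
  have neg: "log_convex_on {..<0} p \<longleftrightarrow> log_convex_on {0<..} ?q"
    using log_convex_on_reflect[of "{..<0}" p] log_convex_on_reflect[of "{0<..}" ?q]
    by (auto simp: refl uminus_image)
  \<comment> \<open>Log-concavity of the reflected density gives the condition on \<open>a2\<close>
    through the second interpretation.\<close>
  have "log_concave_on UNIV p \<Longrightarrow> log_concave_on UNIV ?q"
    using log_concave_on_reflect[of UNIV p] by (simp add: refl)
  then show ?thesis
    unfolding neg
    using D.log_convex_imp D.log_convex_if R.log_convex_imp R.log_convex_if
      D.log_concave_if D.log_concave_imp R.log_concave_imp assms(12)
    by blast
qed

end
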